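(* Let $(\mathcal M_1,Q_1)$ and $(\mathcal M_2,Q_2)$ be Q-manifolds, $\varphi\colon\mathcal M_1\to\mathcal M_2$ a morphism of graded manifolds (a degree preserving map, not necessarily a Q-morphism), and $f\colon\mathcal M_1\to T[1]\mathcal M_2$ its field strength map. Then $f$ is a Q-morphism with respect to the total Q-structure $Q_{T\mathcal M_2}=\mathrm d+\mathcal L_{Q_2}$ on the target $T[1]\mathcal M_2$, that is, $$Q_1f^*-f^*Q_{T\mathcal M_2}=0 .$$
   Context: A Q-manifold is a graded manifold $\mathcal M$ (with non-negatively graded algebra of functions) endowed with a vector field $Q$ of degree one with $[Q,Q]=2Q^2=0$. A Q-morphism is a degree preserving map whose pullback intertwines the homological vector fields. $\Omega(\mathcal M)$ is the algebra of super differential forms, identified (Bernstein-Leites convention) with functions on $T[1]\mathcal M$, generated by $h$ and $\mathrm dh$ ($h\in C^\infty(\mathcal M)$) with $h\,\mathrm dh'=(-1)^{\deg h(\deg h'+1)}\mathrm dh'\,h$ and $\mathrm d(hh')=\mathrm dh\,h'+(-1)^{\deg h}h\,\mathrm dh'$; supercommutativity is with respect to the total degree (form order plus internal degree). For a vector field $X$: $\iota_X(g\,\mathrm dh)=(-1)^{\deg g(\deg X+1)}g\,X(h)$, $\mathcal L_X=\iota_X\mathrm d+(-1)^{\deg X}\mathrm d\iota_X$. Field strength: put $F=Q_1\varphi^*-\varphi^*Q_2\colon C^\infty(\mathcal M_2)\to C^\infty(\mathcal M_1)$, a degree one derivation covering $\varphi^*$. The field strength map $f\colon\mathcal M_1\to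 T[1]\mathcal M_2$ is the morphism of graded manifolds covering $\varphi$ determined by the algebra morphism $f^*\colon\Omega(\mathcal M_2)\to C^\infty(\mathcal M_1)$ with $f^*(h)=\varphi^*(h)$, $f^*(\mathrm dh)=F(h)$ for $h\in C^\infty(\mathcal M_2)$. *)

theory Defs
  imports "HOL-Analysis.Analysis" "HOL-Algebra.Module"
begin

section \<open>Graded commutative real algebras\<close>

definition reals_ring :: "real ring" where
  "reals_ring = \<lparr>carrier = UNIV, monoid.mult = (*), one = 1, ring.zero = 0, add = (+)\<rparr>"

record 'a graded_algebra = "(real, 'a) module" +
  homog :: "int \<Rightarrow> 'a set"

text \<open>The Koszul sign: \<open>koszul A k a\<close> is \<open>(-1)\<close> to the power \<open>k\<close>, times \<open>a\<close>.\<close>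

definition koszul :: "'a graded_algebra \<Rightarrow> int \<Rightarrow> 'a \<Rightarrow> 'a" where
  "koszul A k a = (if even k then a else \<ominus>\<^bsub>A\<^esub> a)"

text \<open>The fourth conjunct says that the carrier is the internal direct sum of the
  homogeneous parts. The last one is supercommutativity with respect to the degree.\<close>

definition graded_comm_algebra :: "'a graded_algebra \<Rightarrow> bool" where
  "graded_comm_algebra A \<longleftrightarrow>
     ring A \<and> Module.module reals_ring A \<and>
     (\<forall>r. \<forall>a\<in>carrier A. \<forall>b\<in>carrier A.
        (r \<odot>\<^bsub>A\<^esub> a) \<otimes>\<^bsub>A\<^esub> b = r \<odot>\<^bsub>A\<^esub> (a \<otimes>\<^bsub>A\<^esub> b) \<and> a \<otimes>\<^bsub>A\<^esub> (r \<odot>\<^bsub>A\<^esub> b) = r \<odot>\<^bsub>A\<^esub> (a \<otimes>\<^bsub>A\<^esub> b)) \<and>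
     ((\<forall>k. submodule (homog A k) reals_ring A) \<and>
      (\<forall>a\<in>carrier A. \<exists>!c. (\<forall>k. c k \<in> homog A k) \<and> finite {k. c k \<noteq> \<zero>\<^bsub>A\<^esub>} \<and>
         a = (\<Oplus>\<^bsub>A\<^esub>k\<in>{k. c k \<noteq> \<zero>\<^bsub>A\<^esub>}. c k))) \<and>
     \<one>\<^bsub>A\<^esub> \<in> homog A 0 \<and>
     (\<forall>i j. \<forall>a\<in>homog A i. \<forall>b\<in>homog A j.
        a \<otimes>\<^bsub>A\<^esub> b \<in> homog A (i + j) \<and> a \<otimes>\<^bsub>A\<^esub> b = koszul A (i * j) (b \<otimes>\<^bsub>A\<^esub> a))"

definition graded_hom :: "'a graded_algebra \<Rightarrow> 'b graded_algebra \<Rightarrow> ('a \<Rightarrow> 'b) set" where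
  "graded_hom A B = {h \<in> ring_hom A B.
     (\<forall>r. \<forall>a\<in>carrier A. h (r \<odot>\<^bsub>A\<^esub> a) = r \<odot>\<^bsub>B\<^esub> h a) \<and>
     (\<forall>k. \<forall>a\<in>homog A k. h a \<in> homog B k)}"


section \<open>Graded manifolds\<close>

text \<open>A topological space with a candidate sheaf of graded algebras. Only open sets are
  relevant as arguments of \<open>sections\<close> and \<open>restr\<close>; \<open>restr M U V\<close> restricts from
  \<open>U\<close> to \<open>V\<close>.\<close>

record ('p, 'a) graded_space =
  body :: "'p topology"
  sections :: "'p set \<Rightarrow> 'a graded_algebra"
  restr :: "'p set \<Rightarrow> 'p set \<Rightarrow> 'a \<Rightarrow> 'a"

definition presheaf :: "('p, 'a) graded_space \<Rightarrow> bool" where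
  "presheaf M \<longleftrightarrow>
     (\<forall>U. openin (body M) U \<longrightarrow> graded_comm_algebra (sections M U)) \<and>
     (\<forall>U V. openin (body M) U \<and> openin (body M) V \<and> V \<subseteq> U \<longrightarrow>
        restr M U V \<in> graded_hom (sections M U) (sections M V)) \<and>
     (\<forall>U. openin (body M) U \<longrightarrow> (\<forall>s\<in>carrier (sections M U). restr M U U s = s)) \<and>
     (\<forall>U V W. openin (body M) U \<and> openin (body M) V \<and> openin (body M) W \<and> W \<subseteq> V \<and> V \<subseteq> U \<longrightarrow>
        (\<forall>s\<in>carrier (sections M U). restr M V W (restr M U V s) = restr M U W s))"

text \<open>A sheaf of graded algebras: gluing is required in every degree. (For inhomogeneous
  sections only uniqueness follows, since the degrees of the pieces of an infinite cover may be
  unbounded.)\<close>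

definition graded_sheaf :: "('p, 'a) graded_space \<Rightarrow> bool" where
  "graded_sheaf M \<longleftrightarrow> presheaf M \<and>
     (\<forall>\<U> k s. (\<forall>U\<in>\<U>. openin (body M) U \<and> s U \<in> homog (sections M U) k) \<and>
        (\<forall>U\<in>\<U>. \<forall>V\<in>\<U>. restr M U (U \<inter> V) (s U) = restr M V (U \<inter> V) (s V)) \<longrightarrow>
        (\<exists>!t. t \<in> homog (sections M (\<Union>\<U>)) k \<and> (\<forall>U\<in>\<U>. restr M (\<Union>\<U>) U t = s U)))"

text \<open>Functions of class \<open>C\<close>-\<open>k\<close> and smooth functions on an open subset \<open>W\<close> of
  \<open>n\<close>-dimensional Euclidean space. The space \<open>Euclidean_space n\<close> consists of sequences
  supported on the first \<open>n\<close> indices, so that \<open>n = 0\<close> is allowed.\<close>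

primrec C_k_on :: "nat \<Rightarrow> nat \<Rightarrow> (nat \<Rightarrow> real) set \<Rightarrow> ((nat \<Rightarrow> real) \<Rightarrow> real) \<Rightarrow> bool" where
  "C_k_on 0 n W f \<longleftrightarrow> continuous_map (subtopology (Euclidean_space n) W) euclideanreal f"
| "C_k_on (Suc k) n W f \<longleftrightarrow> continuous_map (subtopology (Euclidean_space n) W) euclideanreal f \<and>
     (\<forall>i<n. \<exists>g. (\<forall>v\<in>W. ((\<lambda>t. f (v(i := t))) has_real_derivative g v) (at (v i))) \<and>
        C_k_on k n W g)"

definition smooth_on :: "nat \<Rightarrow> (nat \<Rightarrow> real) set \<Rightarrow> ((nat \<Rightarrow> real) \<Rightarrow> real) \<Rightarrow> bool" where
  "smooth_on n W f \<longleftrightarrow> (\<forall>k. C_k_on k n W f)"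

text \<open>The algebra, concentrated in degree \<open>0\<close>, of functions on \<open>V\<close> which are smooth in
  the coordinate system \<open>x\<close>.\<close>

definition smooth_algebra ::
    "nat \<Rightarrow> ('p \<Rightarrow> nat \<Rightarrow> real) \<Rightarrow> 'p set \<Rightarrow> ('p \<Rightarrow> real) graded_algebra" where
  "smooth_algebra n x V = (let S = {f \<in> extensional V. smooth_on n (x ` V) (\<lambda>v. f (inv_into V x v))} in
     \<lparr>carrier = S,
      monoid.mult = (\<lambda>f g. restrict (\<lambda>p. f p * g p) V),
      one = restrict (\<lambda>p. 1) V,
      ring.zero = restrict (\<lambda>p. 0) V,
      add = (\<lambda>f g. restrict (\<lambda>p. f p + g p) V),
      smult = (\<lambda>r f. restrict (\<lambda>p. r * f p) V),
      homog = (\<lambda>k. if k = 0 then S else {restrict (\<lambda>p. 0) V})\<rparr>)"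

text \<open>Exponents of monomials in graded variables of degrees \<open>w\<close>; odd variables occur at
  most once.\<close>

definition exponents :: "int list \<Rightarrow> (nat \<Rightarrow> nat) set" where
  "exponents w = {\<alpha>. (\<forall>i\<ge>length w. \<alpha> i = 0) \<and> (\<forall>i<length w. odd (w ! i) \<longrightarrow> \<alpha> i \<le> 1)}"

definition monomial :: "'a graded_algebra \<Rightarrow> 'a list \<Rightarrow> (nat \<Rightarrow> nat) \<Rightarrow> 'a" where
  "monomial A \<xi> \<alpha> = foldr (\<lambda>i r. ((\<xi> ! i) [^]\<^bsub>A\<^esub> \<alpha> i) \<otimes>\<^bsub>A\<^esub> r) [0..<length \<xi>] \<one>\<^bsub>A\<^esub>"

text \<open>A graded coordinate chart on \<open>U\<close>: ordinary coordinates \<open>x\<close> on the body and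
  coordinates \<open>\<xi>\<close> of positive degrees \<open>w\<close>. Via \<open>\<epsilon>\<close>, the algebra of functions over
  every open \<open>V \<subseteq> U\<close> is the free graded commutative algebra on \<open>\<xi>\<close> over the smooth
  functions on \<open>V\<close>: every section is in a unique way a polynomial in \<open>\<xi>\<close> with smooth
  coefficients. In other words, over \<open>U\<close> the sheaf is isomorphic to the local model.\<close>

definition graded_chart :: "('p, 'a) graded_space \<Rightarrow> 'p set \<Rightarrow> nat \<Rightarrow> int list \<Rightarrow>
    ('p \<Rightarrow> nat \<Rightarrow> real) \<Rightarrow> ('p set \<Rightarrow> ('p \<Rightarrow> real) \<Rightarrow> 'a) \<Rightarrow> 'a list \<Rightarrow> bool" where
  "graded_chart M U n w x \<epsilon> \<xi> \<longleftrightarrow>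
     openin (body M) U \<and> openin (Euclidean_space n) (x ` U) \<and>
     homeomorphic_map (subtopology (body M) U) (subtopology (Euclidean_space n) (x ` U)) x \<and>
     length \<xi> = length w \<and>
     (\<forall>i<length w. 0 < w ! i \<and> \<xi> ! i \<in> homog (sections M U) (w ! i)) \<and>
     (\<forall>V. openin (body M) V \<and> V \<subseteq> U \<longrightarrow>
        \<epsilon> V \<in> graded_hom (smooth_algebra n x V) (sections M V) \<and>
        (\<forall>V'. openin (body M) V' \<and> V' \<subseteq> V \<longrightarrow>
           (\<forall>g\<in>carrier (smooth_algebra n x V). restr M V V' (\<epsilon> V g) = \<epsilon> V' (restrict g V'))) \<and>
        (\<forall>s\<in>carrier (sections M V). \<exists>!c.
           (\<forall>\<alpha>\<in>exponents w. c \<alpha> \<in> carrier (smooth_algebra n x V)) \<and>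
           (\<forall>\<alpha>. \<alpha> \<notin> exponents w \<longrightarrow> c \<alpha> = \<zero>\<^bsub>smooth_algebra n x V\<^esub>) \<and>
           finite {\<alpha>. c \<alpha> \<noteq> \<zero>\<^bsub>smooth_algebra n x V\<^esub>} \<and>
           s = (\<Oplus>\<^bsub>sections M V\<^esub>\<alpha>\<in>{\<alpha>. c \<alpha> \<noteq> \<zero>\<^bsub>smooth_algebra n x V\<^esub>}.
                  \<epsilon> V (c \<alpha>) \<otimes>\<^bsub>sections M V\<^esub> monomial (sections M V) (map (restr M U V) \<xi>) \<alpha>)))"

text \<open>Non-negatively graded manifolds. Smooth compatibility of the coordinates \<open>x\<close> of
  different charts is automatic, since the degree \<open>0\<close> sections recover the smooth functions
  on the body.\<close>

definition graded_manifold :: "('p, 'a) graded_space \<Rightarrow> bool" where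
  "graded_manifold M \<longleftrightarrow>
     Hausdorff_space (body M) \<and> second_countable (body M) \<and> graded_sheaf M \<and>
     (\<exists>n w. \<forall>p\<in>topspace (body M). \<exists>U x \<epsilon> \<xi>. p \<in> U \<and> graded_chart M U n w x \<epsilon> \<xi>)"

text \<open>A morphism consists of a map \<open>\<phi>\<^sub>0\<close> of the bodies and a pullback \<open>\<phi>\<close>, where
  \<open>\<phi> V\<close> acts on functions over the open subset \<open>V\<close> of the target. Compatibility of
  \<open>\<phi>\<close> in degree \<open>0\<close> with composition by \<open>\<phi>\<^sub>0\<close> is automatic.\<close>

definition preim :: "('p, 'a) graded_space \<Rightarrow> ('p \<Rightarrow> 'q) \<Rightarrow> 'q set \<Rightarrow> 'p set" where
  "preim M \<phi>\<^sub>0 V = {p \<in> topspace (body M). \<phi>\<^sub>0 p \<in> V}"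

definition graded_morphism :: "('p, 'a) graded_space \<Rightarrow> ('q, 'b) graded_space \<Rightarrow>
    ('p \<Rightarrow> 'q) \<Rightarrow> ('q set \<Rightarrow> 'b \<Rightarrow> 'a) \<Rightarrow> bool" where
  "graded_morphism M N \<phi>\<^sub>0 \<phi> \<longleftrightarrow>
     continuous_map (body M) (body N) \<phi>\<^sub>0 \<and>
     (\<forall>V. openin (body N) V \<longrightarrow> \<phi> V \<in> graded_hom (sections N V) (sections M (preim M \<phi>\<^sub>0 V))) \<and>
     (\<forall>V V'. openin (body N) V \<and> openin (body N) V' \<and> V' \<subseteq> V \<longrightarrow>
        (\<forall>h\<in>carrier (sections N V).
           restr M (preim M \<phi>\<^sub>0 V) (preim M \<phi>\<^sub>0 V') (\<phi> V h) = \<phi> V' (restr N V V' h)))"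


section \<open>Vector fields and Q-manifolds\<close>

text \<open>\<open>vector_field M p X\<close>: \<open>X\<close> is a vector field of degree \<open>p\<close>, that is, a graded
  derivation of the sheaf of functions.\<close>

definition vector_field :: "('p, 'a) graded_space \<Rightarrow> int \<Rightarrow> ('p set \<Rightarrow> 'a \<Rightarrow> 'a) \<Rightarrow> bool" where
  "vector_field M p X \<longleftrightarrow>
     (\<forall>U. openin (body M) U \<longrightarrow> (let A = sections M U in
        X U \<in> carrier A \<rightarrow> carrier A \<and>
        (\<forall>a\<in>carrier A. \<forall>b\<in>carrier A. X U (a \<oplus>\<^bsub>A\<^esub> b) = X U a \<oplus>\<^bsub>A\<^esub> X U b) \<and>
        (\<forall>r. \<forall>a\<in>carrier A. X U (r \<odot>\<^bsub>A\<^esub> a) = r \<odot>\<^bsub>A\<^esub> X U a) \<and>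
        (\<forall>k. \<forall>a\<in>homog A k. X U a \<in> homog A (k + p)) \<and>
        (\<forall>k. \<forall>a\<in>homog A k. \<forall>b\<in>carrier A.
           X U (a \<otimes>\<^bsub>A\<^esub> b) = X U a \<otimes>\<^bsub>A\<^esub> b \<oplus>\<^bsub>A\<^esub> koszul A (p * k) (a \<otimes>\<^bsub>A\<^esub> X U b)))) \<and>
     (\<forall>U V. openin (body M) U \<and> openin (body M) V \<and> V \<subseteq> U \<longrightarrow>
        (\<forall>a\<in>carrier (sections M U). restr M U V (X U a) = X V (restr M U V a)))"

definition homological :: "('p, 'a) graded_space \<Rightarrow> ('p set \<Rightarrow> 'a \<Rightarrow> 'a) \<Rightarrow> bool" where
  "homological M Q \<longleftrightarrow> vector_field M 1 Q \<and>
     (\<forall>U. openin (body M) U \<longrightarrow> (\<forall>a\<in>carrier (sections M U). Q U (Q U a) = \<zero>\<^bsub>sections M U\<^esub>))"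

definition Q_manifold :: "('p, 'a) graded_space \<Rightarrow> ('p set \<Rightarrow> 'a \<Rightarrow> 'a) \<Rightarrow> bool" where
  "Q_manifold M Q \<longleftrightarrow> graded_manifold M \<and> homological M Q"

text \<open>The operator \<open>F = Q\<^sub>1 \<phi>\<^sup>* - \<phi>\<^sup>* Q\<^sub>2\<close>, on functions over \<open>V\<close>.\<close>

definition Q_defect :: "('p, 'a) graded_space \<Rightarrow> ('p set \<Rightarrow> 'a \<Rightarrow> 'a) \<Rightarrow> ('q set \<Rightarrow> 'b \<Rightarrow> 'b) \<Rightarrow>
    ('p \<Rightarrow> 'q) \<Rightarrow> ('q set \<Rightarrow> 'b \<Rightarrow> 'a) \<Rightarrow> 'q set \<Rightarrow> 'b \<Rightarrow> 'a" where
  "Q_defect M\<^sub>1 Q\<^sub>1 Q\<^sub>2 \<phi>\<^sub>0 \<phi> V h =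
     Q\<^sub>1 (preim M\<^sub>1 \<phi>\<^sub>0 V) (\<phi> V h) \<ominus>\<^bsub>sections M\<^sub>1 (preim M\<^sub>1 \<phi>\<^sub>0 V)\<^esub> \<phi> V (Q\<^sub>2 V h)"

definition Q_morphism :: "('p, 'a) graded_space \<Rightarrow> ('p set \<Rightarrow> 'a \<Rightarrow> 'a) \<Rightarrow>
    ('q, 'b) graded_space \<Rightarrow> ('q set \<Rightarrow> 'b \<Rightarrow> 'b) \<Rightarrow> ('p \<Rightarrow> 'q) \<Rightarrow> ('q set \<Rightarrow> 'b \<Rightarrow> 'a) \<Rightarrow> bool" where
  "Q_morphism M\<^sub>1 Q\<^sub>1 M\<^sub>2 Q\<^sub>2 \<phi>\<^sub>0 \<phi> \<longleftrightarrow>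
     Q_manifold M\<^sub>1 Q\<^sub>1 \<and> Q_manifold M\<^sub>2 Q\<^sub>2 \<and> graded_morphism M\<^sub>1 M\<^sub>2 \<phi>\<^sub>0 \<phi> \<and>
     (\<forall>V. openin (body M\<^sub>2) V \<longrightarrow> (\<forall>h\<in>carrier (sections M\<^sub>2 V).
        Q_defect M\<^sub>1 Q\<^sub>1 Q\<^sub>2 \<phi>\<^sub>0 \<phi> V h = \<zero>\<^bsub>sections M\<^sub>1 (preim M\<^sub>1 \<phi>\<^sub>0 V)\<^esub>))"


section \<open>Super differential forms and the shifted tangent bundle\<close>

text \<open>\<open>T\<close> is \<open>T[1]M\<close>, with sections over \<open>U\<close> the super differential forms on \<open>U\<close>,
  graded by total degree; \<open>\<pi>\<close> is the inclusion of functions into forms, that is, the pullback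
  along the bundle projection, which is the identity on the bodies; \<open>d\<close> is the de Rham
  differential. Any coordinates \<open>(x, \<xi>)\<close> on \<open>M\<close> induce coordinates
  \<open>(x, \<xi>, dx, d\<xi>)\<close> on \<open>T[1]M\<close>, and this determines \<open>(T, \<pi>, d)\<close> up to unique
  isomorphism.\<close>

definition shifted_tangent :: "('q, 'b) graded_space \<Rightarrow> ('q, 'c) graded_space \<Rightarrow>
    ('q set \<Rightarrow> 'b \<Rightarrow> 'c) \<Rightarrow> ('q set \<Rightarrow> 'c \<Rightarrow> 'c) \<Rightarrow> bool" where
  "shifted_tangent M T \<pi> d \<longleftrightarrow>
     graded_manifold T \<and> body T = body M \<and> graded_morphism T M id \<pi> \<and> homological T d \<and>
     (\<forall>U n w x \<epsilon> \<xi>. graded_chart M U n w x \<epsilon> \<xi> \<longrightarrow>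
        graded_chart T U n (w @ replicate n 1 @ map (\<lambda>k. k + 1) w) x (\<lambda>V g. \<pi> V (\<epsilon> V g))
          (map (\<pi> U) \<xi> @
           map (\<lambda>a. d U (\<pi> U (\<epsilon> U (restrict (\<lambda>p. x p a) U)))) [0..<n] @
           map (\<lambda>s. d U (\<pi> U s)) \<xi>))"

text \<open>\<open>\<iota>\<close> is the contraction with the vector field \<open>X\<close> of degree \<open>p\<close>: the derivation
  of the algebra of forms, of total degree \<open>p - 1\<close>, given by the formula for \<open>\<iota>\<^sub>X\<close> on
  functions and on one-forms \<open>g dh\<close>.\<close>

definition contraction :: "('q, 'b) graded_space \<Rightarrow> ('q, 'c) graded_space \<Rightarrow>
    ('q set \<Rightarrow> 'b \<Rightarrow> 'c) \<Rightarrow> ('q set \<Rightarrow> 'c \<Rightarrow> 'c) \<Rightarrow> int \<Rightarrow> ('q set \<Rightarrow> 'b \<Rightarrow> 'b) \<Rightarrow>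
    ('q set \<Rightarrow> 'c \<Rightarrow> 'c) \<Rightarrow> bool" where
  "contraction M T \<pi> d p X \<iota> \<longleftrightarrow> vector_field T (p - 1) \<iota> \<and>
     (\<forall>U. openin (body M) U \<longrightarrow>
        (\<forall>g\<in>carrier (sections M U). \<iota> U (\<pi> U g) = \<zero>\<^bsub>sections T U\<^esub>) \<and>
        (\<forall>k. \<forall>g\<in>homog (sections M U) k. \<forall>h\<in>carrier (sections M U).
           \<iota> U (\<pi> U g \<otimes>\<^bsub>sections T U\<^esub> d U (\<pi> U h)) =
             koszul (sections T U) (k * (p + 1)) (\<pi> U g \<otimes>\<^bsub>sections T U\<^esub> \<pi> U (X U h))))"

definition lie_derivative :: "('q, 'c) graded_space \<Rightarrow> ('q set \<Rightarrow> 'c \<Rightarrow> 'c) \<Rightarrow> int \<Rightarrow>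
    ('q set \<Rightarrow> 'c \<Rightarrow> 'c) \<Rightarrow> 'q set \<Rightarrow> 'c \<Rightarrow> 'c" where
  "lie_derivative T d p \<iota> U \<omega> =
     \<iota> U (d U \<omega>) \<oplus>\<^bsub>sections T U\<^esub> koszul (sections T U) p (d U (\<iota> U \<omega>))"

text \<open>The total Q-structure \<open>d + L\<^sub>Q\<close>, for \<open>\<iota>\<close> the contraction with \<open>Q\<close> (of degree 1).\<close>

definition total_Q :: "('q, 'c) graded_space \<Rightarrow> ('q set \<Rightarrow> 'c \<Rightarrow> 'c) \<Rightarrow>
    ('q set \<Rightarrow> 'c \<Rightarrow> 'c) \<Rightarrow> 'q set \<Rightarrow> 'c \<Rightarrow> 'c" where
  "total_Q T d \<iota> U \<omega> = d U \<omega> \<oplus>\<^bsub>sections T U\<^esub> lie_derivative T d 1 \<iota> U \<omega>"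

definition field_strength_map :: "('p, 'a) graded_space \<Rightarrow> ('p set \<Rightarrow> 'a \<Rightarrow> 'a) \<Rightarrow>
    ('q, 'b) graded_space \<Rightarrow> ('q set \<Rightarrow> 'b \<Rightarrow> 'b) \<Rightarrow> ('p \<Rightarrow> 'q) \<Rightarrow> ('q set \<Rightarrow> 'b \<Rightarrow> 'a) \<Rightarrow>
    ('q, 'c) graded_space \<Rightarrow> ('q set \<Rightarrow> 'b \<Rightarrow> 'c) \<Rightarrow> ('q set \<Rightarrow> 'c \<Rightarrow> 'c) \<Rightarrow>
    ('q set \<Rightarrow> 'c \<Rightarrow> 'a) \<Rightarrow> bool" where
  "field_strength_map M\<^sub>1 Q\<^sub>1 M\<^sub>2 Q\<^sub>2 \<phi>\<^sub>0 \<phi> T \<pi> d f \<longleftrightarrow> graded_morphism M\<^sub>1 T \<phi>\<^sub>0 f \<and>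
     (\<forall>V. openin (body M\<^sub>2) V \<longrightarrow> (\<forall>h\<in>carrier (sections M\<^sub>2 V).
        f V (\<pi> V h) = \<phi> V h \<and>
        f V (d V (\<pi> V h)) = Q_defect M\<^sub>1 Q\<^sub>1 Q\<^sub>2 \<phi>\<^sub>0 \<phi> V h))"

end

theory Submission
  imports Defs
begin

text \<open>Write \<open>D = d + L\<^sub>Q\<close> for the total structure on \<open>T[1]M\<^sub>2\<close>, with \<open>Q = Q\<^sub>2\<close>. The theorem
  asserts two identities: \<open>D\<close> squares to zero, and \<open>\<Delta> = Q\<^sub>1 f\<^sup>* - f\<^sup>* D\<close> vanishes. Both are
  instances of one rigidity principle (\<open>derivation_on_forms_zero\<close>): a derivation of the forms,
  covering a morphism into \<open>T[1]M\<^sub>2\<close> and compatible with restriction, is zero as soon as it kills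
  the functions \<open>h\<close> and their differentials \<open>dh\<close>. Now \<open>D\<^sup>2\<close> is a derivation because
  \<open>D\<close> is an odd one (\<open>odd_derivation_square\<close>), and \<open>\<Delta>\<close> is a derivation along \<open>f\<^sup>*\<close>
  (\<open>derivation_defect\<close>), so both identities need to be verified on generators only.

  On generators, Cartan calculus gives \<open>D h = dh + Q h\<close> and \<open>D dh = - d (Q h)\<close>
  (\<open>total_Q_generators\<close>), hence
  \<open>D\<^sup>2 h = - d (Q h) + d (Q h) + Q (Q h) = 0\<close> and \<open>D\<^sup>2 dh = d (Q (Q h)) = 0\<close>.
  With \<open>F = Q\<^sub>1 \<phi>\<^sup>* - \<phi>\<^sup>* Q\<close> one finds
  \<open>\<Delta> h = Q\<^sub>1 \<phi>\<^sup>* h - F h - \<phi>\<^sup>* Q h = 0\<close> and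
  \<open>\<Delta> dh = Q\<^sub>1 F h + F Q h = Q\<^sub>1\<^sup>2 \<phi>\<^sup>* h - \<phi>\<^sup>* Q\<^sup>2 h = 0\<close>, which is the Bianchi identity.

  The rigidity principle itself is a passage from local to global. Over a chart every form is a
  polynomial in the fibre coordinates, their differentials and the differentials of the base
  coordinates, with functions as coefficients (\<open>forms_locally_generated\<close>). A homogeneous section
  that vanishes on a cover is zero by the sheaf property (\<open>homogeneous_section_zero\<close>), and
  an arbitrary form is a finite sum of homogeneous ones.\<close>

section \<open>Graded algebras and Koszul signs\<close>

locale gc_algebra =
  fixes A :: "'a graded_algebra" (structure)
  assumes gc_algebra: "graded_comm_algebra A"
begin

sublocale ring A
  using gc_algebra unfolding graded_comm_algebra_def by blast

lemma real_module: "module reals_ring A"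
  using gc_algebra unfolding graded_comm_algebra_def by blast

lemma homog_submodule: "submodule (homog A k) reals_ring A"
  using gc_algebra unfolding graded_comm_algebra_def by blast

lemma homog_carrier: "a \<in> homog A k \<Longrightarrow> a \<in> carrier A"
  using submodule.axioms(1)[OF homog_submodule, THEN subgroup.subset] by auto

lemma zero_homog: "\<zero> \<in> homog A k"
  using submodule.axioms(1)[OF homog_submodule, THEN subgroup.one_closed] by simp

lemma add_homog: "a \<in> homog A k \<Longrightarrow> b \<in> homog A k \<Longrightarrow> a \<oplus> b \<in> homog A k"
  using subgroup.m_closed[OF submodule.axioms(1)[OF homog_submodule[of k]]] by simp

lemma neg_homog: "a \<in> homog A k \<Longrightarrow> \<ominus> a \<in> homog A k"
  using subgroup.m_inv_closed[OF submodule.axioms(1)[OF homog_submodule[of k]]]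
  by (simp add: a_inv_def)

lemma one_homog: "\<one> \<in> homog A 0"
  using gc_algebra unfolding graded_comm_algebra_def by blast

lemma mult_homog: "a \<in> homog A i \<Longrightarrow> b \<in> homog A j \<Longrightarrow> a \<otimes> b \<in> homog A (i + j)"
  using gc_algebra unfolding graded_comm_algebra_def by blast

lemma pow_homog: "a \<in> homog A i \<Longrightarrow> a [^] (n::nat) \<in> homog A (int n * i)"
proof (induction n)
  case 0
  then show ?case by (simp add: one_homog)
next
  case (Suc n)
  then have "a [^] n \<otimes> a \<in> homog A (int n * i + i)"
    by (intro mult_homog) auto
  then show ?case by (simp add: algebra_simps)
qed

lemma smult_carrier: "a \<in> carrier A \<Longrightarrow> r \<odot> a \<in> carrier A"
  by (rule module.smult_closed[OF real_module]) (simp_all add: reals_ring_def)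

lemma smult_add: "a \<in> carrier A \<Longrightarrow> b \<in> carrier A \<Longrightarrow> r \<odot> (a \<oplus> b) = r \<odot> a \<oplus> r \<odot> b"
  by (rule module.smult_r_distr[OF real_module]) (simp_all add: reals_ring_def)

lemma smult_neg: "a \<in> carrier A \<Longrightarrow> r \<odot> (\<ominus> a) = \<ominus> (r \<odot> a)"
  by (rule module.smult_r_minus[OF real_module]) (simp_all add: reals_ring_def)

lemma homog_decomposition:
  assumes "a \<in> carrier A"
  obtains c where "\<And>k. c k \<in> homog A k" "finite {k. c k \<noteq> \<zero>}"
    "a = (\<Oplus>k\<in>{k. c k \<noteq> \<zero>}. c k)"
proof -
  have "\<exists>!c. (\<forall>k. c k \<in> homog A k) \<and> finite {k. c k \<noteq> \<zero>} \<and> a = (\<Oplus>k\<in>{k. c k \<noteq> \<zero>}. c k)"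
    using gc_algebra assms unfolding graded_comm_algebra_def by blast
  then show thesis using that by (blast dest: ex1_implies_ex)
qed

lemma finsum_preserves:
  assumes "finite S" "\<And>x. x \<in> S \<Longrightarrow> g x \<in> carrier A \<and> P (g x)" "P \<zero>"
    and add: "\<And>a b. \<lbrakk>a \<in> carrier A; b \<in> carrier A; P a; P b\<rbrakk> \<Longrightarrow> P (a \<oplus> b)"
  shows "P (\<Oplus>x\<in>S. g x)"
  using assms(1,2)
proof (induction S)
  case empty
  then show ?case using assms(3) by simp
next
  case (insert x S)
  then have "g \<in> S \<rightarrow> carrier A" "g x \<in> carrier A" by auto
  then show ?case using insert add[of "g x" "\<Oplus>x\<in>S. g x"]
    by (simp add: finsum_insert)
qed

lemma koszul_closed [simp]: "a \<in> carrier A \<Longrightarrow> koszul A k a \<in> carrier A"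
  by (simp add: koszul_def)

lemma koszul_homog: "a \<in> homog A i \<Longrightarrow> koszul A k a \<in> homog A i"
  by (simp add: koszul_def neg_homog)

lemma koszul_add:
  "a \<in> carrier A \<Longrightarrow> b \<in> carrier A \<Longrightarrow> koszul A k (a \<oplus> b) = koszul A k a \<oplus> koszul A k b"
  by (simp add: koszul_def minus_add)

lemma koszul_smult: "a \<in> carrier A \<Longrightarrow> koszul A k (r \<odot> a) = r \<odot> koszul A k a"
  by (simp add: koszul_def smult_neg)

lemma koszul_koszul: "a \<in> carrier A \<Longrightarrow> koszul A k (koszul A l a) = koszul A (k + l) a"
  by (simp add: koszul_def)

lemma koszul_mult:
  assumes "a \<in> carrier A" "b \<in> carrier A"
  shows "koszul A k a \<otimes> b = koszul A k (a \<otimes> b)" "a \<otimes> koszul A k b = koszul A k (a \<otimes> b)"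
  using assms by (simp_all add: koszul_def l_minus r_minus)

lemma koszul_zero [simp]: "koszul A k \<zero> = \<zero>"
  by (simp add: koszul_def)

lemma koszul_cancel:
  assumes "a \<in> carrier A" "odd (k + l)"
  shows "koszul A k a \<oplus> koszul A l a = \<zero>"
  using assms by (auto simp: koszul_def r_neg l_neg)

end

section \<open>Graded derivations\<close>

text \<open>Derivations along an algebra morphism \<open>\<phi>\<close> are needed besides those of a single
  algebra: the defect of a morphism with respect to two vector fields is one. A vector field is
  the case where \<open>\<phi>\<close> is the identity.\<close>
definition graded_derivation :: "'a graded_algebra \<Rightarrow> 'b graded_algebra \<Rightarrow> ('a \<Rightarrow> 'b) \<Rightarrow> int \<Rightarrow>
    ('a \<Rightarrow> 'b) \<Rightarrow> bool" where
  "graded_derivation A B \<phi> p E \<longleftrightarrow>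
     E \<in> carrier A \<rightarrow> carrier B \<and>
     (\<forall>a\<in>carrier A. \<forall>b\<in>carrier A. E (a \<oplus>\<^bsub>A\<^esub> b) = E a \<oplus>\<^bsub>B\<^esub> E b) \<and>
     (\<forall>r. \<forall>a\<in>carrier A. E (r \<odot>\<^bsub>A\<^esub> a) = r \<odot>\<^bsub>B\<^esub> E a) \<and>
     (\<forall>k. \<forall>a\<in>homog A k. E a \<in> homog B (k + p)) \<and>
     (\<forall>k. \<forall>a\<in>homog A k. \<forall>b\<in>carrier A.
        E (a \<otimes>\<^bsub>A\<^esub> b) = E a \<otimes>\<^bsub>B\<^esub> \<phi> b \<oplus>\<^bsub>B\<^esub> koszul B (p * k) (\<phi> a \<otimes>\<^bsub>B\<^esub> E b))"

lemma graded_derivationD: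
  assumes "graded_derivation A B \<phi> p E"
  shows "a \<in> carrier A \<Longrightarrow> E a \<in> carrier B"
    and "a \<in> carrier A \<Longrightarrow> b \<in> carrier A \<Longrightarrow> E (a \<oplus>\<^bsub>A\<^esub> b) = E a \<oplus>\<^bsub>B\<^esub> E b"
    and "a \<in> carrier A \<Longrightarrow> E (r \<odot>\<^bsub>A\<^esub> a) = r \<odot>\<^bsub>B\<^esub> E a"
    and "a \<in> homog A k \<Longrightarrow> E a \<in> homog B (k + p)"
    and "a \<in> homog A k \<Longrightarrow> b \<in> carrier A \<Longrightarrow>
        E (a \<otimes>\<^bsub>A\<^esub> b) = E a \<otimes>\<^bsub>B\<^esub> \<phi> b \<oplus>\<^bsub>B\<^esub> koszul B (p * k) (\<phi> a \<otimes>\<^bsub>B\<^esub> E b)"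
  using assms by (auto simp: graded_derivation_def)

lemma vector_field_iff_derivations:
  "vector_field M p X \<longleftrightarrow>
     (\<forall>U. openin (body M) U \<longrightarrow>
        graded_derivation (sections M U) (sections M U) (\<lambda>a. a) p (X U)) \<and>
     (\<forall>U V. openin (body M) U \<and> openin (body M) V \<and> V \<subseteq> U \<longrightarrow>
        (\<forall>a\<in>carrier (sections M U). restr M U V (X U a) = X V (restr M U V a)))"
  by (simp add: vector_field_def graded_derivation_def Let_def)

lemma graded_homD:
  assumes "h \<in> graded_hom A B"
  shows "a \<in> carrier A \<Longrightarrow> h a \<in> carrier B"
    and "a \<in> carrier A \<Longrightarrow> b \<in> carrier A \<Longrightarrow> h (a \<oplus>\<^bsub>A\<^esub> b) = h a \<oplus>\<^bsub>B\<^esub> h b"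
    and "a \<in> carrier A \<Longrightarrow> b \<in> carrier A \<Longrightarrow> h (a \<otimes>\<^bsub>A\<^esub> b) = h a \<otimes>\<^bsub>B\<^esub> h b"
    and "h \<one>\<^bsub>A\<^esub> = \<one>\<^bsub>B\<^esub>"
    and "a \<in> carrier A \<Longrightarrow> h (r \<odot>\<^bsub>A\<^esub> a) = r \<odot>\<^bsub>B\<^esub> h a"
    and "a \<in> homog A k \<Longrightarrow> h a \<in> homog B k"
  using assms by (auto simp: graded_hom_def ring_hom_def)

lemma additive_zero_neg:
  assumes "gc_algebra A" "gc_algebra B"
    and cl: "\<And>a. a \<in> carrier A \<Longrightarrow> h a \<in> carrier B"
    and add: "\<And>a b. a \<in> carrier A \<Longrightarrow> b \<in> carrier A \<Longrightarrow> h (a \<oplus>\<^bsub>A\<^esub> b) = h a \<oplus>\<^bsub>B\<^esub> h b"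
  shows additive_zero: "h \<zero>\<^bsub>A\<^esub> = \<zero>\<^bsub>B\<^esub>"
    and additive_neg: "a \<in> carrier A \<Longrightarrow> h (\<ominus>\<^bsub>A\<^esub> a) = \<ominus>\<^bsub>B\<^esub> h a"
    and additive_koszul: "a \<in> carrier A \<Longrightarrow> h (koszul A k a) = koszul B k (h a)"
proof -
  interpret A: gc_algebra A by fact
  interpret B: gc_algebra B by fact
  show z: "h \<zero>\<^bsub>A\<^esub> = \<zero>\<^bsub>B\<^esub>"
    using add[of "\<zero>\<^bsub>A\<^esub>" "\<zero>\<^bsub>A\<^esub>"] cl[of "\<zero>\<^bsub>A\<^esub>"] B.add.r_cancel_one' by simp
  show n: "h (\<ominus>\<^bsub>A\<^esub> a) = \<ominus>\<^bsub>B\<^esub> h a" if "a \<in> carrier A" for a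
    using add[of "\<ominus>\<^bsub>A\<^esub> a" a] cl that z by (simp add: A.l_neg B.minus_equality)
  show "h (koszul A k a) = koszul B k (h a)" if "a \<in> carrier A"
    using n that by (simp add: koszul_def)
qed

lemma derivation_zero_neg:
  assumes "gc_algebra A" "gc_algebra B" "graded_derivation A B \<phi> p E"
  shows derivation_zero: "E \<zero>\<^bsub>A\<^esub> = \<zero>\<^bsub>B\<^esub>"
    and derivation_neg: "a \<in> carrier A \<Longrightarrow> E (\<ominus>\<^bsub>A\<^esub> a) = \<ominus>\<^bsub>B\<^esub> E a"
    and derivation_koszul: "a \<in> carrier A \<Longrightarrow> E (koszul A k a) = koszul B k (E a)"
  using additive_zero_neg[of A B E, OF assms(1,2) graded_derivationD(1,2)[OF assms(3)]] by auto

lemma graded_hom_zero_neg: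
  assumes "gc_algebra A" "gc_algebra B" "h \<in> graded_hom A B"
  shows graded_hom_zero: "h \<zero>\<^bsub>A\<^esub> = \<zero>\<^bsub>B\<^esub>"
    and graded_hom_neg: "a \<in> carrier A \<Longrightarrow> h (\<ominus>\<^bsub>A\<^esub> a) = \<ominus>\<^bsub>B\<^esub> h a"
    and graded_hom_koszul: "a \<in> carrier A \<Longrightarrow> h (koszul A k a) = koszul B k (h a)"
  using additive_zero_neg[of A B h, OF assms(1,2) graded_homD(1,2)[OF assms(3)]] by auto

lemma derivation_kernel_mult:
  assumes "gc_algebra A" "gc_algebra B" "\<phi> \<in> graded_hom A B" "graded_derivation A B \<phi> p E"
    and "a \<in> homog A k" "b \<in> carrier A" "E a = \<zero>\<^bsub>B\<^esub>" "E b = \<zero>\<^bsub>B\<^esub>"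
  shows "E (a \<otimes>\<^bsub>A\<^esub> b) = \<zero>\<^bsub>B\<^esub>"
proof -
  interpret A: gc_algebra A by fact
  interpret B: gc_algebra B by fact
  have "\<phi> a \<in> carrier B" "\<phi> b \<in> carrier B"
    using graded_homD(1)[OF assms(3)] A.homog_carrier[OF assms(5)] assms(6) by auto
  then show ?thesis
    using graded_derivationD(5)[OF assms(4-6)] assms(7,8) by simp
qed

context gc_algebra
begin

text \<open>The second-order Leibniz rule. The two cross terms are isolated because they are what cancels
  both in a graded commutator and in the square of an odd derivation.\<close>
lemma derivation_compose_leibniz:
  assumes X: "graded_derivation A A (\<lambda>a. a) p X" and Y: "graded_derivation A A (\<lambda>a. a) q Y"
    and a: "a \<in> homog A k" and b: "b \<in> carrier A"
  shows "X (Y (a \<otimes> b)) =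
    (X (Y a) \<otimes> b \<oplus> koszul A (p * (k + q)) (Y a \<otimes> X b)) \<oplus>
    (koszul A (q * k) (X a \<otimes> Y b) \<oplus> koszul A ((p + q) * k) (a \<otimes> X (Y b)))"
proof -
  note XD = graded_derivationD[OF X] and YD = graded_derivationD[OF Y]
  have ac: "a \<in> carrier A" using a by (rule homog_carrier)
  have Xk: "X (koszul A (q * k) (a \<otimes> Y b)) = koszul A (q * k) (X (a \<otimes> Y b))"
    by (rule derivation_koszul[OF gc_algebra_axioms gc_algebra_axioms X]) (simp add: ac b YD)
  have "X (Y (a \<otimes> b)) = X (Y a \<otimes> b) \<oplus> koszul A (q * k) (X (a \<otimes> Y b))"
    using ac b by (simp add: YD(5)[OF a b] XD(2) YD(1) Xk)
  also have "X (Y a \<otimes> b) = X (Y a) \<otimes> b \<oplus> koszul A (p * (k + q)) (Y a \<otimes> X b)"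
    by (rule XD(5)[OF YD(4)[OF a] b])
  also have "X (a \<otimes> Y b) = X a \<otimes> Y b \<oplus> koszul A (p * k) (a \<otimes> X (Y b))"
    by (rule XD(5)[OF a YD(1)[OF b]])
  finally show ?thesis
    using ac b by (simp add: koszul_add koszul_koszul XD(1) YD(1) algebra_simps)
qed

text \<open>The graded commutator \<open>X Y - (-1)\<^bsup>p q\<^esup> Y X\<close>, with the minus sign moved into the exponent of
  the Koszul sign: for \<open>X = \<iota>\<close> of degree \<open>p - 1\<close> and \<open>Y = d\<close> of degree
  1 that exponent becomes \<open>p\<close>, and the formula is Cartan's formula for the Lie derivative.\<close>
lemma derivation_commutator:
  assumes X: "graded_derivation A A (\<lambda>a. a) p X" and Y: "graded_derivation A A (\<lambda>a. a) q Y"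
  shows "graded_derivation A A (\<lambda>a. a) (p + q) (\<lambda>a. X (Y a) \<oplus> koszul A (p * q + 1) (Y (X a)))"
proof -
  note XD = graded_derivationD[OF X] and YD = graded_derivationD[OF Y]
  let ?k = "koszul A (p * q + 1)"
  have "X (Y (a \<otimes> b)) \<oplus> ?k (Y (X (a \<otimes> b))) =
      (X (Y a) \<oplus> ?k (Y (X a))) \<otimes> b \<oplus>
      koszul A ((p + q) * k) (a \<otimes> (X (Y b) \<oplus> ?k (Y (X b))))"
    if a: "a \<in> homog A k" and b: "b \<in> carrier A" for a b k
  proof -
    have ac [simp]: "a \<in> carrier A" using a by (rule homog_carrier)
    note [simp] = b XD(1) YD(1)
    \<comment> \<open>Primed letters come from \<open>Y X\<close>. The cross terms \<open>v\<close> and \<open>w\<close> meet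
      \<open>v'\<close> and \<open>w'\<close>, whose Koszul exponents have the opposite parity.\<close>
    define u where "u = X (Y a) \<otimes> b"
    define u' where "u' = ?k (Y (X a) \<otimes> b)"
    define v where "v = koszul A (p * (k + q)) (Y a \<otimes> X b)"
    define v' where "v' = koszul A (p * q + 1 + p * k) (Y a \<otimes> X b)"
    define w where "w = koszul A (q * k) (X a \<otimes> Y b)"
    define w' where "w' = koszul A (p * q + 1 + q * (k + p)) (X a \<otimes> Y b)"
    define z where "z = koszul A ((p + q) * k) (a \<otimes> X (Y b))"
    define z' where "z' = koszul A (p * q + 1 + (q + p) * k) (a \<otimes> Y (X b))"
    note defs = u_def u'_def v_def v'_def w_def w'_def z_def z'_def
    have cl [simp]: "u \<in> carrier A" "u' \<in> carrier A" "v \<in> carrier A" "v' \<in> carrier A"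
      "w \<in> carrier A" "w' \<in> carrier A" "z \<in> carrier A" "z' \<in> carrier A"
      by (simp_all add: defs)
    have v0: "v \<oplus> v' = \<zero>" and w0: "w \<oplus> w' = \<zero>"
      unfolding defs by (intro koszul_cancel; auto)+
    have "X (Y (a \<otimes> b)) \<oplus> ?k (Y (X (a \<otimes> b))) =
        (u \<oplus> v \<oplus> (w \<oplus> z)) \<oplus> ((u' \<oplus> w') \<oplus> (v' \<oplus> z'))"
      by (simp only: derivation_compose_leibniz[OF X Y a b] derivation_compose_leibniz[OF Y X a b])
        (simp add: defs koszul_add koszul_koszul)
    also have "\<dots> = (u \<oplus> u') \<oplus> (v \<oplus> v') \<oplus> (w \<oplus> w') \<oplus> (z \<oplus> z')"
      by (simp add: a_ac)
    also have "\<dots> = (u \<oplus> u') \<oplus> (z \<oplus> z')"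
      by (simp add: v0 w0)
    also have "\<dots> = (X (Y a) \<oplus> ?k (Y (X a))) \<otimes> b \<oplus>
        koszul A ((p + q) * k) (a \<otimes> (X (Y b) \<oplus> ?k (Y (X b))))"
      by (simp add: defs l_distr r_distr koszul_add koszul_mult koszul_koszul add.commute)
    finally show ?thesis .
  qed
  moreover have "X (Y a) \<oplus> ?k (Y (X a)) \<in> homog A (k + (p + q))" if "a \<in> homog A k" for a k
  proof -
    have "X (Y a) \<in> homog A (k + q + p)" "Y (X a) \<in> homog A (k + p + q)"
      using that XD(4) YD(4) by blast+
    then show ?thesis by (intro add_homog koszul_homog) (simp_all add: algebra_simps)
  qed
  ultimately show ?thesis
    unfolding graded_derivation_def
    by (auto simp: XD YD koszul_add koszul_smult a_ac smult_add smult_carrier)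
qed

text \<open>The cross terms \<open>X a \<otimes> X b\<close> carry the signs \<open>(-1)\<^bsup>p (k + p)\<^esup>\<close> and \<open>(-1)\<^bsup>p k\<^esup>\<close>, which are
  opposite for odd \<open>p\<close>.\<close>
lemma odd_derivation_square:
  assumes X: "graded_derivation A A (\<lambda>a. a) p X" and p: "odd p"
  shows "graded_derivation A A (\<lambda>a. a) (2 * p) (\<lambda>a. X (X a))"
proof -
  note XD = graded_derivationD[OF X]
  have "X (X (a \<otimes> b)) = X (X a) \<otimes> b \<oplus> koszul A (2 * p * k) (a \<otimes> X (X b))"
    if a: "a \<in> homog A k" and b: "b \<in> carrier A" for a b k
  proof -
    have ac: "a \<in> carrier A" using a by (rule homog_carrier)
    let ?m = "X a \<otimes> X b"
    have c: "koszul A (p * (k + p)) ?m \<oplus> koszul A (p * k) ?m = \<zero>"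
      using p ac b by (intro koszul_cancel) (auto simp: XD)
    have "X (X (a \<otimes> b)) = X (X a) \<otimes> b \<oplus>
        (koszul A (p * (k + p)) ?m \<oplus> koszul A (p * k) ?m) \<oplus> koszul A (2 * p * k) (a \<otimes> X (X b))"
      using derivation_compose_leibniz[OF X X a b] ac b by (simp add: XD a_assoc)
    then show ?thesis using ac b by (simp only: c) (simp add: XD)
  qed
  moreover have "X (X a) \<in> homog A (k + 2 * p)" if "a \<in> homog A k" for a k
    using XD(4)[OF XD(4)[OF that]] by (simp add: algebra_simps)
  ultimately show ?thesis
    unfolding graded_derivation_def by (auto simp: XD)
qed

lemma derivation_add:
  assumes X: "graded_derivation A A (\<lambda>a. a) p X" and Y: "graded_derivation A A (\<lambda>a. a) p Y"
  shows "graded_derivation A A (\<lambda>a. a) p (\<lambda>a. X a \<oplus> Y a)"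
proof -
  note XD = graded_derivationD[OF X] and YD = graded_derivationD[OF Y]
  have "X (a \<otimes> b) \<oplus> Y (a \<otimes> b) = (X a \<oplus> Y a) \<otimes> b \<oplus> koszul A (p * k) (a \<otimes> (X b \<oplus> Y b))"
    if a: "a \<in> homog A k" and b: "b \<in> carrier A" for a b k
    using homog_carrier[OF a] b
    by (simp add: XD(5)[OF a b] YD(5)[OF a b] XD(1) YD(1) l_distr r_distr koszul_add a_ac)
  then show ?thesis
    unfolding graded_derivation_def
    by (auto simp: XD YD a_ac smult_add add_homog)
qed

end

text \<open>The products \<open>\<phi> (Y a) \<otimes> \<phi> b\<close> and \<open>\<phi> a \<otimes> \<phi> (Y b)\<close> combine with those of \<open>X \<circ> \<phi>\<close>
  without leftover, because \<open>X\<close> and \<open>Y\<close> have the same degree and \<open>\<phi>\<close> preserves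
  degrees.\<close>
lemma derivation_defect:
  assumes "gc_algebra A" "gc_algebra B" and \<phi>: "\<phi> \<in> graded_hom A B"
    and X: "graded_derivation B B (\<lambda>b. b) p X" and Y: "graded_derivation A A (\<lambda>a. a) p Y"
  shows "graded_derivation A B \<phi> p (\<lambda>a. X (\<phi> a) \<ominus>\<^bsub>B\<^esub> \<phi> (Y a))"
proof -
  interpret A: gc_algebra A by fact
  interpret B: gc_algebra B by fact
  note XD = graded_derivationD[OF X] and YD = graded_derivationD[OF Y] and \<phi>D = graded_homD[OF \<phi>]
  note \<phi>z = graded_hom_koszul[OF A.gc_algebra_axioms B.gc_algebra_axioms \<phi>]
  have "X (\<phi> (a \<otimes>\<^bsub>A\<^esub> b)) \<ominus>\<^bsub>B\<^esub> \<phi> (Y (a \<otimes>\<^bsub>A\<^esub> b)) =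
      (X (\<phi> a) \<ominus>\<^bsub>B\<^esub> \<phi> (Y a)) \<otimes>\<^bsub>B\<^esub> \<phi> b \<oplus>\<^bsub>B\<^esub>
      koszul B (p * k) (\<phi> a \<otimes>\<^bsub>B\<^esub> (X (\<phi> b) \<ominus>\<^bsub>B\<^esub> \<phi> (Y b)))"
    if a: "a \<in> homog A k" and b: "b \<in> carrier A" for a b k
  proof -
    have ac [simp]: "a \<in> carrier A" using a by (rule A.homog_carrier)
    note [simp] = b XD(1) YD(1) \<phi>D(1)
    have "X (\<phi> (a \<otimes>\<^bsub>A\<^esub> b)) = X (\<phi> a) \<otimes>\<^bsub>B\<^esub> \<phi> b \<oplus>\<^bsub>B\<^esub> koszul B (p * k) (\<phi> a \<otimes>\<^bsub>B\<^esub> X (\<phi> b))"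
      using XD(5)[OF \<phi>D(6)[OF a]] by (simp add: \<phi>D(3))
    moreover have "\<phi> (Y (a \<otimes>\<^bsub>A\<^esub> b)) =
        \<phi> (Y a) \<otimes>\<^bsub>B\<^esub> \<phi> b \<oplus>\<^bsub>B\<^esub> koszul B (p * k) (\<phi> a \<otimes>\<^bsub>B\<^esub> \<phi> (Y b))"
      by (simp add: YD(5)[OF a b] \<phi>D(2,3) \<phi>z)
    moreover have "\<ominus>\<^bsub>B\<^esub> koszul B n c = koszul B n (\<ominus>\<^bsub>B\<^esub> c)" for n c
      by (simp add: koszul_def)
    ultimately show ?thesis
      by (simp add: B.minus_eq B.minus_add B.l_distr B.r_distr B.koszul_add B.l_minus B.r_minus B.a_ac)
  qed
  moreover have "X (\<phi> a) \<ominus>\<^bsub>B\<^esub> \<phi> (Y a) \<in> homog B (k + p)" if "a \<in> homog A k" for a k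
    unfolding B.minus_eq using that by (intro B.add_homog B.neg_homog) (auto intro: XD YD \<phi>D)
  ultimately show ?thesis
    unfolding graded_derivation_def
    by (auto simp: XD YD \<phi>D B.minus_eq B.minus_add B.a_ac B.smult_add B.smult_neg)
qed

section \<open>Sheaves of derivations\<close>

lemma presheafD:
  assumes "presheaf M"
  shows "openin (body M) U \<Longrightarrow> gc_algebra (sections M U)"
    and "openin (body M) U \<Longrightarrow> openin (body M) V \<Longrightarrow> V \<subseteq> U \<Longrightarrow>
        restr M U V \<in> graded_hom (sections M U) (sections M V)"
  using assms by (auto simp: presheaf_def gc_algebra_def)

lemma graded_manifold_sheaf: "graded_manifold M \<Longrightarrow> graded_sheaf M"
  by (simp add: graded_manifold_def)

lemma graded_sheaf_presheaf: "graded_sheaf M \<Longrightarrow> presheaf M"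
  by (simp add: graded_sheaf_def)

lemma vector_field_add:
  assumes "presheaf M" "vector_field M p X" "vector_field M p Y"
  shows "vector_field M p (\<lambda>U a. X U a \<oplus>\<^bsub>sections M U\<^esub> Y U a)"
  unfolding vector_field_iff_derivations
proof (intro conjI allI impI ballI)
  fix U assume U: "openin (body M) U"
  then show "graded_derivation (sections M U) (sections M U) (\<lambda>a. a) p
      (\<lambda>a. X U a \<oplus>\<^bsub>sections M U\<^esub> Y U a)"
    using assms by (intro gc_algebra.derivation_add presheafD(1)[OF assms(1)])
      (auto simp: vector_field_iff_derivations)
next
  fix U V a assume UV: "openin (body M) U \<and> openin (body M) V \<and> V \<subseteq> U"
    and a: "a \<in> carrier (sections M U)"
  have r: "restr M U V \<in> graded_hom (sections M U) (sections M V)"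
    using UV presheafD(2)[OF assms(1)] by blast
  have "X U a \<in> carrier (sections M U)" "Y U a \<in> carrier (sections M U)"
    "restr M U V (X U a) = X V (restr M U V a)" "restr M U V (Y U a) = Y V (restr M U V a)"
    using assms(2,3) UV a by (auto simp: vector_field_def Let_def)
  then show "restr M U V (X U a \<oplus>\<^bsub>sections M U\<^esub> Y U a) =
      X V (restr M U V a) \<oplus>\<^bsub>sections M V\<^esub> Y V (restr M U V a)"
    by (simp add: graded_homD(2)[OF r])
qed

lemma vector_field_lie_derivative:
  assumes M: "presheaf M" and d: "vector_field M 1 d" and \<iota>: "vector_field M (p - 1) \<iota>"
  shows "vector_field M p (lie_derivative M d p \<iota>)"
  unfolding vector_field_iff_derivations
proof (intro conjI allI impI ballI)
  fix U assume U: "openin (body M) U"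
  show "graded_derivation (sections M U) (sections M U) (\<lambda>a. a) p (lie_derivative M d p \<iota> U)"
    using gc_algebra.derivation_commutator[OF presheafD(1)[OF M U], of "p - 1" "\<iota> U" 1 "d U"] d \<iota> U
    by (simp add: vector_field_iff_derivations lie_derivative_def[abs_def])
next
  fix U V a assume UV: "openin (body M) U \<and> openin (body M) V \<and> V \<subseteq> U"
    and a: "a \<in> carrier (sections M U)"
  interpret U: gc_algebra "sections M U" using UV M presheafD by blast
  interpret V: gc_algebra "sections M V" using UV M presheafD by blast
  have r: "restr M U V \<in> graded_hom (sections M U) (sections M V)" using UV M presheafD by blast
  have D: "graded_derivation (sections M U) (sections M U) (\<lambda>a. a) 1 (d U)"
    "graded_derivation (sections M U) (sections M U) (\<lambda>a. a) (p - 1) (\<iota> U)"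
    using d \<iota> UV by (auto simp: vector_field_iff_derivations)
  note cl = graded_derivationD(1)[OF D(1)] graded_derivationD(1)[OF D(2)]
  have c: "restr M U V (d U s) = d V (restr M U V s)" "restr M U V (\<iota> U s) = \<iota> V (restr M U V s)"
    if "s \<in> carrier (sections M U)" for s
    using d \<iota> UV that by (auto simp: vector_field_def)
  show "restr M U V (lie_derivative M d p \<iota> U a) = lie_derivative M d p \<iota> V (restr M U V a)"
    using graded_hom_koszul[OF U.gc_algebra_axioms V.gc_algebra_axioms r]
    by (simp add: lie_derivative_def graded_homD(2)[OF r] a cl c)
qed

text \<open>Both \<open>t\<close> and zero glue the family of zero sections. Homogeneity matters: the gluing axiom
  is about sections of one fixed degree.\<close>
lemma homogeneous_section_zero:
  assumes M: "graded_sheaf M" and op: "\<And>U. U \<in> \<U> \<Longrightarrow> openin (body M) U"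
    and t: "t \<in> homog (sections M (\<Union>\<U>)) k"
    and z: "\<And>U. U \<in> \<U> \<Longrightarrow> restr M (\<Union>\<U>) U t = \<zero>\<^bsub>sections M U\<^esub>"
  shows "t = \<zero>\<^bsub>sections M (\<Union>\<U>)\<^esub>"
proof -
  note P = presheafD[OF graded_sheaf_presheaf[OF M]]
  have opU: "openin (body M) (\<Union>\<U>)" using op by blast
  have r0: "restr M U V \<zero>\<^bsub>sections M U\<^esub> = \<zero>\<^bsub>sections M V\<^esub>"
    if "openin (body M) U" "openin (body M) V" "V \<subseteq> U" for U V
    using graded_hom_zero[OF P(1) P(1) P(2)] that by blast
  have glue: "\<forall>\<U> k s. (\<forall>U\<in>\<U>. openin (body M) U \<and> s U \<in> homog (sections M U) k) \<and>
      (\<forall>U\<in>\<U>. \<forall>V\<in>\<U>. restr M U (U \<inter> V) (s U) = restr M V (U \<inter> V) (s V)) \<longrightarrow>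
      (\<exists>!t. t \<in> homog (sections M (\<Union>\<U>)) k \<and> (\<forall>U\<in>\<U>. restr M (\<Union>\<U>) U t = s U))"
    by (rule conjunct2[OF M[unfolded graded_sheaf_def]])
  have "\<exists>!t. t \<in> homog (sections M (\<Union>\<U>)) k \<and>
      (\<forall>U\<in>\<U>. restr M (\<Union>\<U>) U t = \<zero>\<^bsub>sections M U\<^esub>)"
    by (rule glue[rule_format, of \<U> "\<lambda>U. \<zero>\<^bsub>sections M U\<^esub>" k])
      (use op in \<open>auto simp: r0 openin_Int gc_algebra.zero_homog[OF P(1)]\<close>)
  moreover have "\<zero>\<^bsub>sections M (\<Union>\<U>)\<^esub> \<in> homog (sections M (\<Union>\<U>)) k"
    by (rule gc_algebra.zero_homog[OF P(1)[OF opU]])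
  moreover have "restr M (\<Union>\<U>) U \<zero>\<^bsub>sections M (\<Union>\<U>)\<^esub> = \<zero>\<^bsub>sections M U\<^esub>" if "U \<in> \<U>" for U
    using that op opU by (intro r0) auto
  ultimately show ?thesis using t z by blast
qed

section \<open>Coordinate functions are smooth\<close>

lemma C_k_on_const: "C_k_on k n W (\<lambda>v. c)"
  by (induction k arbitrary: c) (auto intro!: exI[of _ "\<lambda>v. 0"])

lemma continuous_map_Euclidean_space_update:
  assumes "v \<in> topspace (Euclidean_space n)" "i < n"
  shows "continuous_map euclideanreal (Euclidean_space n) (\<lambda>t. v(i := t))"
  using assms unfolding Euclidean_space_def
  by (auto simp: continuous_map_in_subtopology continuous_map_componentwise_UNIV
      topspace_Euclidean_space)

text \<open>Function values outside \<open>W\<close> are arbitrary. They do not affect the partial derivatives: since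
  \<open>W\<close> is open in Euclidean space, it contains a piece of each coordinate line through each of
  its points.\<close>
lemma smooth_on_coordinate:
  assumes W: "openin (Euclidean_space n) W" and f: "\<And>v. v \<in> W \<Longrightarrow> f v = v a"
  shows "smooth_on n W f"
  unfolding smooth_on_def
proof
  fix k
  have "continuous_map (Euclidean_space n) euclideanreal (\<lambda>v. v a)"
    unfolding Euclidean_space_def
    by (intro continuous_map_from_subtopology continuous_map_product_projection) simp
  then have cont: "continuous_map (subtopology (Euclidean_space n) W) euclideanreal f"
    by (rule continuous_map_eq[OF continuous_map_from_subtopology]) (simp add: f)
  have "((\<lambda>t. f (v(i := t))) has_real_derivative (if i = a then 1 else 0)) (at (v i))"
    if v: "v \<in> W" and i: "i < n" for v i
  proof -
    have vE: "v \<in> topspace (Euclidean_space n)" using v openin_subset[OF W] by blast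
    have "open {t. v(i := t) \<in> W}"
      using openin_continuous_map_preimage[OF continuous_map_Euclidean_space_update[OF vE i] W]
      by simp
    then have "\<forall>\<^sub>F t in nhds (v i). v(i := t) \<in> W"
      using v eventually_nhds_in_open[of "{t. v(i := t) \<in> W}" "v i"] by simp
    then have ev: "\<forall>\<^sub>F t in nhds (v i). f (v(i := t)) = (v(i := t)) a"
      by (rule eventually_mono) (rule f)
    have "((\<lambda>t. (v(i := t)) a) has_real_derivative (if i = a then 1 else 0)) (at (v i))"
      by auto
    then show ?thesis by (simp only: DERIV_cong_ev[OF refl ev refl])
  qed
  then show "C_k_on k n W f"
    using cont by (cases k) (auto intro!: exI C_k_on_const)
qed

text \<open>The base coordinates of a chart are genuine functions on the graded manifold. Without this,
  the fibre coordinates \<open>dx\<close> of the induced chart on \<open>T[1]M\<close> could not be recognised as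
  differentials of functions.\<close>
lemma chart_coordinate_section:
  assumes "graded_chart M U n w x \<epsilon> \<xi>"
  shows "\<epsilon> U (restrict (\<lambda>p. x p a) U) \<in> carrier (sections M U)"
proof -
  have U: "openin (body M) U" and W: "openin (Euclidean_space n) (x ` U)"
    and x: "homeomorphic_map (subtopology (body M) U) (subtopology (Euclidean_space n) (x ` U)) x"
    and \<epsilon>: "\<epsilon> U \<in> graded_hom (smooth_algebra n x U) (sections M U)"
    using assms by (auto simp: graded_chart_def)
  have inj: "inj_on x U"
    using homeomorphic_imp_injective_map[OF x] openin_subset[OF U] by (simp add: Int_absorb1)
  have "smooth_on n (x ` U) (\<lambda>v. restrict (\<lambda>p. x p a) U (inv_into U x v))"
    by (rule smooth_on_coordinate[OF W, of _ a]) (auto simp: inj)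
  then have "restrict (\<lambda>p. x p a) U \<in> carrier (smooth_algebra n x U)"
    by (simp add: smooth_algebra_def Let_def)
  then show ?thesis by (rule graded_homD(1)[OF \<epsilon>])
qed

section \<open>Functions and exact one-forms generate the forms locally\<close>

lemma (in gc_algebra) monomial_preserves:
  assumes gen: "\<And>i. i < length \<xi> \<Longrightarrow> P (\<xi> ! i) \<and> (\<exists>k. \<xi> ! i \<in> homog A k)"
    and one: "P \<one>"
    and mult: "\<And>a b k. \<lbrakk>a \<in> homog A k; b \<in> carrier A; P a; P b\<rbrakk> \<Longrightarrow> P (a \<otimes> b)"
  shows "monomial A \<xi> \<alpha> \<in> carrier A \<and> P (monomial A \<xi> \<alpha>)"
proof -
  have pow: "P (a [^] (n::nat))" if "a \<in> homog A k" "P a" for a k n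
  proof (induction n)
    case (Suc n)
    then show ?case
      using mult[OF pow_homog[OF that(1)] homog_carrier[OF that(1)]] that(2) by simp
  qed (simp add: one)
  define m where "m = (\<lambda>is. foldr (\<lambda>i r. ((\<xi> ! i) [^] \<alpha> i) \<otimes> r) is \<one>)"
  have m: "m is \<in> carrier A \<and> P (m is)" if "set is \<subseteq> {..<length \<xi>}" for "is"
    using that
  proof (induction "is")
    case (Cons i "is")
    obtain k where k: "\<xi> ! i \<in> homog A k" "P (\<xi> ! i)"
      using gen[of i] Cons.prems by auto
    show ?case
      using Cons mult[OF pow_homog[OF k(1)], of "m is" "\<alpha> i"] pow[OF k, of "\<alpha> i"]
        homog_carrier[OF pow_homog[OF k(1)], of "\<alpha> i"]
      by (auto simp: m_def)
  qed (simp add: m_def one)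
  from m[of "[0..<length \<xi>]"] show ?thesis by (simp add: monomial_def m_def lessThan_atLeast0)
qed

lemma shifted_tangentD:
  assumes "shifted_tangent M T \<pi> d"
  shows "graded_manifold T" "body T = body M" "vector_field T 1 d"
    and "openin (body M) U \<Longrightarrow> \<pi> U \<in> graded_hom (sections M U) (sections T U)"
    and "openin (body M) U \<Longrightarrow> openin (body M) V \<Longrightarrow> V \<subseteq> U \<Longrightarrow> h \<in> carrier (sections M U) \<Longrightarrow>
        restr T U V (\<pi> U h) = \<pi> V (restr M U V h)"
    and "openin (body M) U \<Longrightarrow> \<omega> \<in> carrier (sections T U) \<Longrightarrow> d U (d U \<omega>) = \<zero>\<^bsub>sections T U\<^esub>"
proof -
  show b: "body T = body M" using assms by (simp add: shifted_tangent_def)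
  have pre: "preim T id U = U" if "openin (body M) U" for U
    using openin_subset[OF that] by (auto simp: preim_def b)
  show "graded_manifold T" "vector_field T 1 d"
    using assms by (simp_all add: shifted_tangent_def homological_def)
  show "\<pi> U \<in> graded_hom (sections M U) (sections T U)" if "openin (body M) U"
    using assms that pre[OF that] by (auto simp: shifted_tangent_def graded_morphism_def)
  show "restr T U V (\<pi> U h) = \<pi> V (restr M U V h)"
    if "openin (body M) U" "openin (body M) V" "V \<subseteq> U" "h \<in> carrier (sections M U)"
  proof -
    have "restr T (preim T id U) (preim T id V) (\<pi> U h) = \<pi> V (restr M U V h)"
      using assms that unfolding shifted_tangent_def graded_morphism_def by blast
    then show ?thesis by (simp add: pre that)
  qed
  show "d U (d U \<omega>) = \<zero>\<^bsub>sections T U\<^esub>"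
    if "openin (body M) U" "\<omega> \<in> carrier (sections T U)"
    using assms that b by (simp add: shifted_tangent_def homological_def)
qed

text \<open>An induction principle for forms over an open subset of a chart domain, read off from the
  normal form in the induced chart of \<open>T[1]M\<close>: coefficients, coordinates \<open>\<xi>\<close> and differentials
  \<open>dx\<close>, \<open>d\<xi>\<close> are all of the form \<open>h\<close> or \<open>dh\<close>. Closure under products is asked
  only for a homogeneous left factor, which is what the graded Leibniz rule provides.\<close>
lemma forms_locally_generated:
  assumes M: "presheaf M" and st: "shifted_tangent M T \<pi> d"
    and chart: "graded_chart M U n w x \<epsilon> \<xi>"
    and V: "openin (body M) V" "V \<subseteq> U"
    and s: "s \<in> carrier (sections T V)"
    and func: "\<And>h. h \<in> carrier (sections M V) \<Longrightarrow> P (\<pi> V h)"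
    and diff: "\<And>h. h \<in> carrier (sections M V) \<Longrightarrow> P (d V (\<pi> V h))"
    and add: "\<And>a b. \<lbrakk>a \<in> carrier (sections T V); b \<in> carrier (sections T V); P a; P b\<rbrakk> \<Longrightarrow>
        P (a \<oplus>\<^bsub>sections T V\<^esub> b)"
    and mult: "\<And>a b k. \<lbrakk>a \<in> homog (sections T V) k; b \<in> carrier (sections T V); P a; P b\<rbrakk> \<Longrightarrow>
        P (a \<otimes>\<^bsub>sections T V\<^esub> b)"
  shows "P s"
proof -
  note T = shifted_tangentD[OF st]
  have pT: "presheaf T" using T(1) graded_manifold_sheaf graded_sheaf_presheaf by blast
  have U: "openin (body M) U" using chart by (simp add: graded_chart_def)
  interpret MV: gc_algebra "sections M V" by (rule presheafD(1)[OF M V(1)])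
  interpret MU: gc_algebra "sections M U" by (rule presheafD(1)[OF M U])
  interpret TV: gc_algebra "sections T V" by (rule presheafD(1)[OF pT]) (simp add: T V)
  note \<pi> = graded_homD[OF T(4)[OF V(1)]]
  define \<xi>' where "\<xi>' = map (\<pi> U) \<xi> @
    map (\<lambda>a. d U (\<pi> U (\<epsilon> U (restrict (\<lambda>p. x p a) U)))) [0..<n] @ map (\<lambda>s. d U (\<pi> U s)) \<xi>"
  define w' where "w' = w @ replicate n 1 @ map (\<lambda>k. k + 1) w"
  have chart': "graded_chart T U n w' x (\<lambda>V g. \<pi> V (\<epsilon> V g)) \<xi>'"
    using st chart unfolding shifted_tangent_def \<xi>'_def w'_def by blast
  have rT: "restr T U V \<in> graded_hom (sections T U) (sections T V)"
    using presheafD(2)[OF pT] T(2) U V by simp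
  have rM: "restr M U V h \<in> carrier (sections M V)" if "h \<in> carrier (sections M U)" for h
    using graded_homD(1)[OF presheafD(2)[OF M U V] that] .
  have r\<pi>: "restr T U V (\<pi> U h) = \<pi> V (restr M U V h)" if "h \<in> carrier (sections M U)" for h
    by (rule T(5)[OF U V that])
  have rd: "restr T U V (d U (\<pi> U h)) = d V (\<pi> V (restr M U V h))"
    if h: "h \<in> carrier (sections M U)" for h
    using T(2,3) U V graded_homD(1)[OF T(4)[OF U] h] r\<pi>[OF h] by (simp add: vector_field_def)
  have gen: "P (restr T U V b)" if b: "b \<in> set \<xi>'" for b
  proof -
    have \<xi>: "h \<in> carrier (sections M U)" if "h \<in> set \<xi>" for h
      using chart that MU.homog_carrier by (auto simp: graded_chart_def in_set_conv_nth)
    obtain h where "h \<in> carrier (sections M U)" "b = \<pi> U h \<or> b = d U (\<pi> U h)"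
      using b \<xi> chart_coordinate_section[OF chart] by (auto simp: \<xi>'_def)
    then show ?thesis using func diff rM r\<pi> rd by auto
  qed
  have P1: "P \<one>\<^bsub>sections T V\<^esub>"
    using func[OF MV.one_closed] by (simp add: \<pi>(4))
  have P0: "P \<zero>\<^bsub>sections T V\<^esub>"
    using func[OF MV.zero_closed]
    by (simp add: graded_hom_zero[OF MV.gc_algebra_axioms TV.gc_algebra_axioms T(4)[OF V(1)]])
  have mono: "monomial (sections T V) (map (restr T U V) \<xi>') \<alpha> \<in> carrier (sections T V) \<and>
      P (monomial (sections T V) (map (restr T U V) \<xi>') \<alpha>)" for \<alpha>
  proof (rule TV.monomial_preserves[OF _ P1 mult])
    fix i assume i: "i < length (map (restr T U V) \<xi>')"
    then have "\<xi>' ! i \<in> homog (sections T U) (w' ! i)"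
      using chart' by (simp add: graded_chart_def)
    then have "restr T U V (\<xi>' ! i) \<in> homog (sections T V) (w' ! i)"
      by (rule graded_homD(6)[OF rT])
    then show "P (map (restr T U V) \<xi>' ! i) \<and>
        (\<exists>k. map (restr T U V) \<xi>' ! i \<in> homog (sections T V) k)"
      using gen i by auto
  qed
  let ?A = "smooth_algebra n x V"
  have "\<exists>!c. (\<forall>\<alpha>\<in>exponents w'. c \<alpha> \<in> carrier ?A) \<and>
      (\<forall>\<alpha>. \<alpha> \<notin> exponents w' \<longrightarrow> c \<alpha> = \<zero>\<^bsub>?A\<^esub>) \<and> finite {\<alpha>. c \<alpha> \<noteq> \<zero>\<^bsub>?A\<^esub>} \<and>
      s = (\<Oplus>\<^bsub>sections T V\<^esub>\<alpha>\<in>{\<alpha>. c \<alpha> \<noteq> \<zero>\<^bsub>?A\<^esub>}. \<pi> V (\<epsilon> V (c \<alpha>)) \<otimes>\<^bsub>sections T V\<^esub>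
          monomial (sections T V) (map (restr T U V) \<xi>') \<alpha>)"
    using chart' V T(2) s unfolding graded_chart_def by simp
  then obtain c where c: "\<forall>\<alpha>\<in>exponents w'. c \<alpha> \<in> carrier ?A"
      "\<forall>\<alpha>. \<alpha> \<notin> exponents w' \<longrightarrow> c \<alpha> = \<zero>\<^bsub>?A\<^esub>" "finite {\<alpha>. c \<alpha> \<noteq> \<zero>\<^bsub>?A\<^esub>}"
    and sc: "s = (\<Oplus>\<^bsub>sections T V\<^esub>\<alpha>\<in>{\<alpha>. c \<alpha> \<noteq> \<zero>\<^bsub>?A\<^esub>}. \<pi> V (\<epsilon> V (c \<alpha>)) \<otimes>\<^bsub>sections T V\<^esub>
          monomial (sections T V) (map (restr T U V) \<xi>') \<alpha>)"
    by (elim ex1E conjE) (rule that; assumption)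
  have \<epsilon>: "\<epsilon> V \<in> graded_hom ?A (sections M V)"
    using chart V by (simp add: graded_chart_def)
  show ?thesis
    unfolding sc
  proof (rule TV.finsum_preserves[OF c(3) _ P0 add])
    fix \<alpha> assume "\<alpha> \<in> {\<alpha>. c \<alpha> \<noteq> \<zero>\<^bsub>?A\<^esub>}"
    then have "c \<alpha> \<in> carrier ?A" using c(1,2) by blast
    \<comment> \<open>The coefficients have degree 0, so the left factor of each term is homogeneous.\<close>
    then have "c \<alpha> \<in> homog ?A 0" by (simp add: smooth_algebra_def Let_def)
    then have e: "\<epsilon> V (c \<alpha>) \<in> homog (sections M V) 0" by (rule graded_homD(6)[OF \<epsilon>])
    then have pe: "\<pi> V (\<epsilon> V (c \<alpha>)) \<in> homog (sections T V) 0" by (rule \<pi>(6))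
    show "\<pi> V (\<epsilon> V (c \<alpha>)) \<otimes>\<^bsub>sections T V\<^esub> monomial (sections T V) (map (restr T U V) \<xi>') \<alpha>
        \<in> carrier (sections T V) \<and>
        P (\<pi> V (\<epsilon> V (c \<alpha>)) \<otimes>\<^bsub>sections T V\<^esub> monomial (sections T V) (map (restr T U V) \<xi>') \<alpha>)"
      using mono[of \<alpha>] mult[OF pe] func[OF MV.homog_carrier[OF e]] TV.homog_carrier[OF pe] by simp
  qed
qed

section \<open>Rigidity of derivations of the forms\<close>

text \<open>The kernel of a derivation is closed under sums and under products with a homogeneous left
  factor, so over a chart it contains all forms. The sheaf property of the source \<open>N\<close>, applied to
  preimages of chart domains, spreads this to homogeneous forms over any open set.\<close>
lemma derivation_on_forms_zero:
  assumes M: "graded_manifold M" and N: "graded_sheaf N" and st: "shifted_tangent M T \<pi> d"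
    and \<psi>: "graded_morphism N T \<psi>\<^sub>0 \<psi>"
    and E: "\<And>V. openin (body M) V \<Longrightarrow>
        graded_derivation (sections T V) (sections N (preim N \<psi>\<^sub>0 V)) (\<psi> V) p (E V)"
    and restr: "\<And>V V' s. \<lbrakk>openin (body M) V; openin (body M) V'; V' \<subseteq> V;
        s \<in> carrier (sections T V)\<rbrakk> \<Longrightarrow>
        restr N (preim N \<psi>\<^sub>0 V) (preim N \<psi>\<^sub>0 V') (E V s) = E V' (restr T V V' s)"
    and func: "\<And>V h. \<lbrakk>openin (body M) V; h \<in> carrier (sections M V)\<rbrakk> \<Longrightarrow>
        E V (\<pi> V h) = \<zero>\<^bsub>sections N (preim N \<psi>\<^sub>0 V)\<^esub>"
    and diff: "\<And>V h. \<lbrakk>openin (body M) V; h \<in> carrier (sections M V)\<rbrakk> \<Longrightarrow>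
        E V (d V (\<pi> V h)) = \<zero>\<^bsub>sections N (preim N \<psi>\<^sub>0 V)\<^esub>"
    and V: "openin (body M) V" and s: "s \<in> carrier (sections T V)"
  shows "E V s = \<zero>\<^bsub>sections N (preim N \<psi>\<^sub>0 V)\<^esub>"
proof -
  let ?pre = "preim N \<psi>\<^sub>0"
  note T = shifted_tangentD[OF st]
  have pM: "presheaf M" and pT: "presheaf T"
    using M T(1) graded_manifold_sheaf graded_sheaf_presheaf by blast+
  note pN = graded_sheaf_presheaf[OF N]
  have pre: "openin (body N) (?pre V)" if "openin (body M) V" for V
    using \<psi> that T(2) unfolding graded_morphism_def preim_def
    by (auto intro: openin_continuous_map_preimage)
  have gT: "gc_algebra (sections T V)" and gN: "gc_algebra (sections N (?pre V))"
    if "openin (body M) V" for V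
    using presheafD(1)[OF pT] presheafD(1)[OF pN pre[OF that]] T(2) that by auto
  have \<psi>h: "\<psi> V \<in> graded_hom (sections T V) (sections N (?pre V))" if "openin (body M) V" for V
    using \<psi> that T(2) by (simp add: graded_morphism_def)
  have on_chart: "E V s = \<zero>\<^bsub>sections N (?pre V)\<^esub>"
    if chart: "graded_chart M U n w x \<epsilon> \<xi>" and V: "openin (body M) V" "V \<subseteq> U"
      and s: "s \<in> carrier (sections T V)" for U n w x \<epsilon> \<xi> V s
  proof (rule forms_locally_generated[OF pM st chart V s, of "\<lambda>s. E V s = \<zero>\<^bsub>sections N (?pre V)\<^esub>"])
    interpret NV: gc_algebra "sections N (?pre V)" by (rule gN[OF V(1)])
    show "E V (a \<oplus>\<^bsub>sections T V\<^esub> b) = \<zero>\<^bsub>sections N (?pre V)\<^esub>"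
      if "a \<in> carrier (sections T V)" "b \<in> carrier (sections T V)"
        "E V a = \<zero>\<^bsub>sections N (?pre V)\<^esub>" "E V b = \<zero>\<^bsub>sections N (?pre V)\<^esub>" for a b
      using that by (simp add: graded_derivationD(2)[OF E[OF V(1)]])
    show "E V (a \<otimes>\<^bsub>sections T V\<^esub> b) = \<zero>\<^bsub>sections N (?pre V)\<^esub>"
      if "a \<in> homog (sections T V) k" "b \<in> carrier (sections T V)"
        "E V a = \<zero>\<^bsub>sections N (?pre V)\<^esub>" "E V b = \<zero>\<^bsub>sections N (?pre V)\<^esub>" for a b k
      by (rule derivation_kernel_mult[OF gT[OF V(1)] gN[OF V(1)] \<psi>h[OF V(1)] E[OF V(1)] that])
  qed (use func diff V in auto)
  interpret TV: gc_algebra "sections T V" by (rule gT[OF V])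
  interpret NV: gc_algebra "sections N (?pre V)" by (rule gN[OF V])
  have homogeneous: "E V s = \<zero>\<^bsub>sections N (?pre V)\<^esub>" if s: "s \<in> homog (sections T V) k" for s k
  proof -
    define \<C> where "\<C> = {U. \<exists>n w x \<epsilon> \<xi>. graded_chart M U n w x \<epsilon> \<xi>}"
    define \<U> where "\<U> = (\<lambda>U. ?pre (V \<inter> U)) ` \<C>"
    have opC: "openin (body M) (V \<inter> U)" if "U \<in> \<C>" for U
      using that V by (auto simp: \<C>_def graded_chart_def)
    have "topspace (body M) \<subseteq> \<Union>\<C>"
      using M unfolding graded_manifold_def \<C>_def by blast
    then have cover: "\<Union>\<U> = ?pre V"
      using openin_subset[OF V] unfolding \<U>_def preim_def by blast
    have "E V s = \<zero>\<^bsub>sections N (\<Union>\<U>)\<^esub>"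
    proof (rule homogeneous_section_zero[OF N])
      show "E V s \<in> homog (sections N (\<Union>\<U>)) (k + p)"
        unfolding cover by (rule graded_derivationD(4)[OF E[OF V] s])
      show "openin (body N) W" if "W \<in> \<U>" for W
        using that opC pre by (auto simp: \<U>_def)
      show "restr N (\<Union>\<U>) W (E V s) = \<zero>\<^bsub>sections N W\<^esub>" if W: "W \<in> \<U>" for W
      proof -
        obtain U where U: "U \<in> \<C>" "W = ?pre (V \<inter> U)" using W by (auto simp: \<U>_def)
        have "restr N (\<Union>\<U>) W (E V s) = E (V \<inter> U) (restr T V (V \<inter> U) s)"
          unfolding cover U(2) using restr[OF V opC[OF U(1)]] TV.homog_carrier[OF s] by simp
        also have "\<dots> = \<zero>\<^bsub>sections N W\<^esub>"
        proof -
          have "restr T V (V \<inter> U) s \<in> carrier (sections T (V \<inter> U))"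
            by (rule graded_homD(1)[OF presheafD(2)[OF pT]])
              (use V opC[OF U(1)] T(2) TV.homog_carrier[OF s] in auto)
          then show ?thesis
            using U on_chart opC[OF U(1)] unfolding \<C>_def by blast
        qed
        finally show ?thesis .
      qed
    qed
    then show ?thesis by (simp add: cover)
  qed
  obtain c where c: "\<And>k. c k \<in> homog (sections T V) k" "finite {k. c k \<noteq> \<zero>\<^bsub>sections T V\<^esub>}"
    "s = (\<Oplus>\<^bsub>sections T V\<^esub>k\<in>{k. c k \<noteq> \<zero>\<^bsub>sections T V\<^esub>}. c k)"
    using TV.homog_decomposition[OF s] by blast
  show ?thesis
    unfolding c(3)
  proof (rule TV.finsum_preserves[OF c(2)])
    show "c k \<in> carrier (sections T V) \<and> E V (c k) = \<zero>\<^bsub>sections N (?pre V)\<^esub>" for k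
      using c(1) homogeneous TV.homog_carrier by blast
    show "E V \<zero>\<^bsub>sections T V\<^esub> = \<zero>\<^bsub>sections N (?pre V)\<^esub>"
      by (rule homogeneous[OF TV.zero_homog])
    show "E V (a \<oplus>\<^bsub>sections T V\<^esub> b) = \<zero>\<^bsub>sections N (?pre V)\<^esub>"
      if "a \<in> carrier (sections T V)" "b \<in> carrier (sections T V)"
        "E V a = \<zero>\<^bsub>sections N (?pre V)\<^esub>" "E V b = \<zero>\<^bsub>sections N (?pre V)\<^esub>" for a b
      using that by (simp add: graded_derivationD(2)[OF E[OF V]])
  qed
qed

section \<open>The total Q-structure\<close>

lemma vector_field_total_Q:
  assumes "presheaf T" "vector_field T 1 d" "vector_field T 0 \<iota>"
  shows "vector_field T 1 (total_Q T d \<iota>)"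
  using vector_field_add[OF assms(1,2) vector_field_lie_derivative[OF assms(1,2), of 1 \<iota>]] assms(3)
  by (simp add: total_Q_def[abs_def])

text \<open>Here \<open>L\<^sub>Q h = \<iota>\<^sub>Q dh = Q h\<close>, since \<open>\<iota>\<^sub>Q\<close> kills functions, and
  \<open>L\<^sub>Q dh = - d \<iota>\<^sub>Q dh = - d (Q h)\<close>, since \<open>d\<^sup>2 = 0\<close>.\<close>
lemma total_Q_generators:
  assumes M: "presheaf M" and Q: "vector_field M 1 Q" and st: "shifted_tangent M T \<pi> d"
    and \<iota>: "contraction M T \<pi> d 1 Q \<iota>"
    and U: "openin (body M) U" and h: "h \<in> carrier (sections M U)"
  shows "total_Q T d \<iota> U (\<pi> U h) = d U (\<pi> U h) \<oplus>\<^bsub>sections T U\<^esub> \<pi> U (Q U h)"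
    and "total_Q T d \<iota> U (d U (\<pi> U h)) = \<ominus>\<^bsub>sections T U\<^esub> d U (\<pi> U (Q U h))"
proof -
  note T = shifted_tangentD[OF st]
  have pT: "presheaf T" using T(1) graded_manifold_sheaf graded_sheaf_presheaf by blast
  interpret MU: gc_algebra "sections M U" by (rule presheafD(1)[OF M U])
  interpret TU: gc_algebra "sections T U" by (rule presheafD(1)[OF pT]) (simp add: T U)
  note \<pi> = graded_homD[OF T(4)[OF U]]
  have Qh: "Q U h \<in> carrier (sections M U)"
    using Q U h by (auto simp: vector_field_def Let_def)
  have dD: "graded_derivation (sections T U) (sections T U) (\<lambda>a. a) 1 (d U)"
    and \<iota>D: "graded_derivation (sections T U) (sections T U) (\<lambda>a. a) 0 (\<iota> U)"
    using T(2,3) \<iota> U by (auto simp: contraction_def vector_field_iff_derivations)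
  note [simp] = h Qh \<pi>(1) graded_derivationD(1)[OF dD]
    derivation_zero[OF TU.gc_algebra_axioms TU.gc_algebra_axioms dD]
    derivation_zero[OF TU.gc_algebra_axioms TU.gc_algebra_axioms \<iota>D]
  have i0: "\<iota> U (\<pi> U h) = \<zero>\<^bsub>sections T U\<^esub>" if "h \<in> carrier (sections M U)" for h
    using \<iota> U that by (auto simp: contraction_def)
  \<comment> \<open>The contraction is prescribed on \<open>g dh\<close>; its value on \<open>dh\<close> is the case \<open>g = 1\<close>.\<close>
  have "\<iota> U (\<pi> U \<one>\<^bsub>sections M U\<^esub> \<otimes>\<^bsub>sections T U\<^esub> d U (\<pi> U h)) =
      koszul (sections T U) (0 * (1 + 1)) (\<pi> U \<one>\<^bsub>sections M U\<^esub> \<otimes>\<^bsub>sections T U\<^esub> \<pi> U (Q U h))"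
    using \<iota> U h MU.one_homog unfolding contraction_def by blast
  then have i1: "\<iota> U (d U (\<pi> U h)) = \<pi> U (Q U h)"
    by (simp add: \<pi>(4) koszul_def)
  show "total_Q T d \<iota> U (\<pi> U h) = d U (\<pi> U h) \<oplus>\<^bsub>sections T U\<^esub> \<pi> U (Q U h)"
    by (simp add: total_Q_def lie_derivative_def i0 i1)
  show "total_Q T d \<iota> U (d U (\<pi> U h)) = \<ominus>\<^bsub>sections T U\<^esub> d U (\<pi> U (Q U h))"
    by (simp add: total_Q_def lie_derivative_def i1 T(6)[OF U] koszul_def)
qed

text \<open>Rigidity along the identity of \<open>T[1]M\<close>, applied to the derivation \<open>D\<^sup>2\<close> of degree 2.\<close>
lemma homological_total_Q:
  assumes M: "graded_manifold M" and Q: "homological M Q" and st: "shifted_tangent M T \<pi> d"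
    and \<iota>: "contraction M T \<pi> d 1 Q \<iota>"
  shows "homological T (total_Q T d \<iota>)"
proof -
  let ?D = "total_Q T d \<iota>"
  note T = shifted_tangentD[OF st]
  have sT: "graded_sheaf T" and pT: "presheaf T" and pM: "presheaf M"
    using M T(1) graded_manifold_sheaf graded_sheaf_presheaf by blast+
  have pre: "preim T id U = U" if "openin (body M) U" for U
    using openin_subset[OF that] by (auto simp: preim_def T(2))
  have vD: "vector_field T 1 ?D"
    using vector_field_total_Q[OF pT T(3)] \<iota> by (simp add: contraction_def)
  have vQ: "vector_field M 1 Q" using Q by (simp add: homological_def)
  have gT: "gc_algebra (sections T U)" if "openin (body M) U" for U
    using presheafD(1)[OF pT] that T(2) by simp
  have D: "graded_derivation (sections T U) (sections T U) (\<lambda>a. a) 1 (?D U)"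
    if "openin (body M) U" for U
    using vD that T(2) by (simp add: vector_field_iff_derivations)
  have "graded_morphism T T id (\<lambda>V a. a)"
    using T(2) pre by (auto simp: graded_morphism_def graded_hom_def ring_hom_def)
  then have zero: "?D U (?D U s) = \<zero>\<^bsub>sections T (preim T id U)\<^esub>"
    if U: "openin (body M) U" and s: "s \<in> carrier (sections T U)" for U s
  proof (rule derivation_on_forms_zero[OF M sT st _ _ _ _ _ U s, where E = "\<lambda>U s. ?D U (?D U s)"])
    show "graded_derivation (sections T V) (sections T (preim T id V)) (\<lambda>a. a) (2 * 1)
        (\<lambda>s. ?D V (?D V s))" if V: "openin (body M) V" for V
      unfolding pre[OF V] by (rule gc_algebra.odd_derivation_square[OF gT[OF V] D[OF V]]) simp
    show "restr T (preim T id V) (preim T id V') (?D V (?D V s)) =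
        ?D V' (?D V' (restr T V V' s))"
      if V: "openin (body M) V" and V': "openin (body M) V'" "V' \<subseteq> V"
        and s: "s \<in> carrier (sections T V)" for V V' s
      using vD V V' s graded_derivationD(1)[OF D[OF V] s] T(2) unfolding pre[OF V] pre[OF V'(1)]
      by (simp add: vector_field_iff_derivations)
    fix V h assume V: "openin (body M) V" and h: "h \<in> carrier (sections M V)"
    interpret TV: gc_algebra "sections T V" by (rule gT[OF V])
    have QQ: "Q V (Q V h) = \<zero>\<^bsub>sections M V\<^esub>" and Qh: "Q V h \<in> carrier (sections M V)"
      using Q V h by (auto simp: homological_def vector_field_def Let_def)
    have dD: "graded_derivation (sections T V) (sections T V) (\<lambda>a. a) 1 (d V)"
      using T(2,3) V by (simp add: vector_field_iff_derivations)
    note \<pi> = graded_homD[OF T(4)[OF V]]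
    have \<pi>0: "\<pi> V \<zero>\<^bsub>sections M V\<^esub> = \<zero>\<^bsub>sections T V\<^esub>"
      by (rule graded_hom_zero[OF presheafD(1)[OF pM V] TV.gc_algebra_axioms T(4)[OF V]])
    have d0: "d V \<zero>\<^bsub>sections T V\<^esub> = \<zero>\<^bsub>sections T V\<^esub>"
      by (rule derivation_zero[OF TV.gc_algebra_axioms TV.gc_algebra_axioms dD])
    note gen = total_Q_generators[OF pM vQ st \<iota> V]
    note [simp] = h Qh \<pi>(1) graded_derivationD(1)[OF dD] graded_derivationD(2)[OF D[OF V]]
      derivation_neg[OF TV.gc_algebra_axioms TV.gc_algebra_axioms D[OF V]]
    show "?D V (?D V (\<pi> V h)) = \<zero>\<^bsub>sections T (preim T id V)\<^esub>"
      by (simp add: pre[OF V] gen QQ \<pi>0 TV.l_neg)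
    show "?D V (?D V (d V (\<pi> V h))) = \<zero>\<^bsub>sections T (preim T id V)\<^esub>"
      by (simp add: pre[OF V] gen QQ \<pi>0 d0)
  qed
  then show ?thesis
    using vD T(2) pre by (simp add: homological_def)
qed

section \<open>The field strength map\<close>

theorem proposition3p3:
  fixes M\<^sub>1 :: "('p, 'a) graded_space" and Q\<^sub>1 :: "'p set \<Rightarrow> 'a \<Rightarrow> 'a"
    and M\<^sub>2 :: "('q, 'b) graded_space" and Q\<^sub>2 :: "'q set \<Rightarrow> 'b \<Rightarrow> 'b"
    and \<phi>\<^sub>0 :: "'p \<Rightarrow> 'q" and \<phi> :: "'q set \<Rightarrow> 'b \<Rightarrow> 'a"
    and T :: "('q, 'c) graded_space" and \<pi> :: "'q set \<Rightarrow> 'b \<Rightarrow> 'c"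
    and d \<iota> :: "'q set \<Rightarrow> 'c \<Rightarrow> 'c" and f :: "'q set \<Rightarrow> 'c \<Rightarrow> 'a"
  assumes "Q_manifold M\<^sub>1 Q\<^sub>1" and "Q_manifold M\<^sub>2 Q\<^sub>2"
    and "graded_morphism M\<^sub>1 M\<^sub>2 \<phi>\<^sub>0 \<phi>"
    and "shifted_tangent M\<^sub>2 T \<pi> d"
    and "contraction M\<^sub>2 T \<pi> d 1 Q\<^sub>2 \<iota>"
    and "field_strength_map M\<^sub>1 Q\<^sub>1 M\<^sub>2 Q\<^sub>2 \<phi>\<^sub>0 \<phi> T \<pi> d f"
  shows "Q_morphism M\<^sub>1 Q\<^sub>1 T (total_Q T d \<iota>) \<phi>\<^sub>0 f"
proof -
  let ?D = "total_Q T d \<iota>" and ?pre = "preim M\<^sub>1 \<phi>\<^sub>0"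
  note T = shifted_tangentD[OF assms(4)]
  have M1: "graded_manifold M\<^sub>1" and Q1: "vector_field M\<^sub>1 1 Q\<^sub>1" and M2: "graded_manifold M\<^sub>2"
    and Q2: "homological M\<^sub>2 Q\<^sub>2" and vQ2: "vector_field M\<^sub>2 1 Q\<^sub>2"
    using assms(1,2) by (simp_all add: Q_manifold_def homological_def)
  have QQ1: "Q\<^sub>1 U (Q\<^sub>1 U a) = \<zero>\<^bsub>sections M\<^sub>1 U\<^esub>"
    if "openin (body M\<^sub>1) U" "a \<in> carrier (sections M\<^sub>1 U)" for U a
    using assms(1) that by (simp add: Q_manifold_def homological_def)
  have s1: "graded_sheaf M\<^sub>1" and p1: "presheaf M\<^sub>1" and p2: "presheaf M\<^sub>2" and pT: "presheaf T"
    using M1 M2 T(1) graded_manifold_sheaf graded_sheaf_presheaf by blast+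
  have f: "graded_morphism M\<^sub>1 T \<phi>\<^sub>0 f"
    using assms(6) by (simp add: field_strength_map_def)
  have f\<pi>: "f V (\<pi> V h) = \<phi> V h"
    and fd: "f V (d V (\<pi> V h)) = Q_defect M\<^sub>1 Q\<^sub>1 Q\<^sub>2 \<phi>\<^sub>0 \<phi> V h"
    if "openin (body M\<^sub>2) V" "h \<in> carrier (sections M\<^sub>2 V)" for V h
    using assms(6) that by (auto simp: field_strength_map_def)
  have hD: "homological T ?D" by (rule homological_total_Q[OF M2 Q2 assms(4,5)])
  then have vD: "vector_field T 1 ?D" by (simp add: homological_def)
  have pre: "openin (body M\<^sub>1) (?pre V)" if "openin (body M\<^sub>2) V" for V
    using assms(3) that unfolding graded_morphism_def preim_def
    by (auto intro: openin_continuous_map_preimage)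
  have g1: "gc_algebra (sections M\<^sub>1 (?pre V))" and gT: "gc_algebra (sections T V)"
    and Q1D: "graded_derivation (sections M\<^sub>1 (?pre V)) (sections M\<^sub>1 (?pre V)) (\<lambda>a. a) 1 (Q\<^sub>1 (?pre V))"
    and DD: "graded_derivation (sections T V) (sections T V) (\<lambda>a. a) 1 (?D V)"
    and fh: "f V \<in> graded_hom (sections T V) (sections M\<^sub>1 (?pre V))"
    and \<phi>h: "\<phi> V \<in> graded_hom (sections M\<^sub>2 V) (sections M\<^sub>1 (?pre V))"
    if "openin (body M\<^sub>2) V" for V
    using presheafD(1)[OF p1 pre[OF that]] presheafD(1)[OF pT] T(2) that Q1 vD pre[OF that] f assms(3)
    by (auto simp: vector_field_iff_derivations graded_morphism_def)
  have "Q_defect M\<^sub>1 Q\<^sub>1 ?D \<phi>\<^sub>0 f V \<omega> = \<zero>\<^bsub>sections M\<^sub>1 (?pre V)\<^esub>"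
    if V: "openin (body M\<^sub>2) V" and \<omega>: "\<omega> \<in> carrier (sections T V)" for V \<omega>
  proof (rule derivation_on_forms_zero[OF M2 s1 assms(4) f _ _ _ _ V \<omega>,
        where E = "Q_defect M\<^sub>1 Q\<^sub>1 ?D \<phi>\<^sub>0 f"])
    show "graded_derivation (sections T V) (sections M\<^sub>1 (?pre V)) (f V) 1 (Q_defect M\<^sub>1 Q\<^sub>1 ?D \<phi>\<^sub>0 f V)"
      if V: "openin (body M\<^sub>2) V" for V
      using derivation_defect[OF gT[OF V] g1[OF V] fh[OF V] Q1D[OF V] DD[OF V]]
      by (simp add: Q_defect_def[abs_def])
    show "restr M\<^sub>1 (?pre V) (?pre V') (Q_defect M\<^sub>1 Q\<^sub>1 ?D \<phi>\<^sub>0 f V s) =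
        Q_defect M\<^sub>1 Q\<^sub>1 ?D \<phi>\<^sub>0 f V' (restr T V V' s)"
      if V: "openin (body M\<^sub>2) V" and V': "openin (body M\<^sub>2) V'" "V' \<subseteq> V"
        and s: "s \<in> carrier (sections T V)" for V V' s
    proof -
      interpret N: gc_algebra "sections M\<^sub>1 (?pre V)" by (rule g1[OF V])
      have sub: "?pre V' \<subseteq> ?pre V" using V'(2) by (auto simp: preim_def)
      have r: "restr M\<^sub>1 (?pre V) (?pre V') \<in> graded_hom (sections M\<^sub>1 (?pre V)) (sections M\<^sub>1 (?pre V'))"
        by (rule presheafD(2)[OF p1 pre[OF V] pre[OF V'(1)] sub])
      have cl: "?D V s \<in> carrier (sections T V)" by (rule graded_derivationD(1)[OF DD[OF V] s])
      have rf: "restr M\<^sub>1 (?pre V) (?pre V') (f V a) = f V' (restr T V V' a)"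
        if "a \<in> carrier (sections T V)" for a
        using f V V' that T(2) by (simp add: graded_morphism_def)
      have rQ: "restr M\<^sub>1 (?pre V) (?pre V') (Q\<^sub>1 (?pre V) a) =
          Q\<^sub>1 (?pre V') (restr M\<^sub>1 (?pre V) (?pre V') a)"
        if "a \<in> carrier (sections M\<^sub>1 (?pre V))" for a
        using Q1 pre[OF V] pre[OF V'(1)] sub that by (simp add: vector_field_iff_derivations)
      have rD: "restr T V V' (?D V s) = ?D V' (restr T V V' s)"
        using vD V V' s T(2) by (simp add: vector_field_iff_derivations)
      show ?thesis
        by (simp add: Q_defect_def a_minus_def graded_homD(2)[OF r] graded_homD(1)[OF fh[OF V]]
            graded_derivationD(1)[OF Q1D[OF V]] s cl
            graded_hom_neg[OF N.gc_algebra_axioms g1[OF V'(1)] r] rf rQ rD)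
    qed
    fix V h assume V: "openin (body M\<^sub>2) V" and h: "h \<in> carrier (sections M\<^sub>2 V)"
    interpret N: gc_algebra "sections M\<^sub>1 (?pre V)" by (rule g1[OF V])
    have Qh: "Q\<^sub>2 V h \<in> carrier (sections M\<^sub>2 V)" and QQ: "Q\<^sub>2 V (Q\<^sub>2 V h) = \<zero>\<^bsub>sections M\<^sub>2 V\<^esub>"
      using Q2 V h by (auto simp: homological_def vector_field_def Let_def)
    have dD: "graded_derivation (sections T V) (sections T V) (\<lambda>a. a) 1 (d V)"
      using T(2,3) V by (simp add: vector_field_iff_derivations)
    have \<phi>0: "\<phi> V \<zero>\<^bsub>sections M\<^sub>2 V\<^esub> = \<zero>\<^bsub>sections M\<^sub>1 (?pre V)\<^esub>"
      by (rule graded_hom_zero[OF presheafD(1)[OF p2 V] N.gc_algebra_axioms \<phi>h[OF V]])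
    note gen = total_Q_generators[OF p2 vQ2 assms(4,5) V]
    note [simp] = h Qh graded_homD(1)[OF \<phi>h[OF V]] graded_homD(1)[OF T(4)[OF V]]
      graded_derivationD(1)[OF dD] graded_derivationD(1)[OF Q1D[OF V]]
    show "Q_defect M\<^sub>1 Q\<^sub>1 ?D \<phi>\<^sub>0 f V (\<pi> V h) = \<zero>\<^bsub>sections M\<^sub>1 (?pre V)\<^esub>"
    proof -
      have "f V (?D V (\<pi> V h)) = (Q\<^sub>1 (?pre V) (\<phi> V h) \<ominus>\<^bsub>sections M\<^sub>1 (?pre V)\<^esub> \<phi> V (Q\<^sub>2 V h))
          \<oplus>\<^bsub>sections M\<^sub>1 (?pre V)\<^esub> \<phi> V (Q\<^sub>2 V h)"
        by (simp add: gen graded_homD(2)[OF fh[OF V]] f\<pi>[OF V] fd[OF V] Q_defect_def)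
      also have "\<dots> = Q\<^sub>1 (?pre V) (\<phi> V h)"
        by (simp add: N.minus_eq N.a_assoc N.l_neg)
      finally have "f V (?D V (\<pi> V h)) = Q\<^sub>1 (?pre V) (\<phi> V h)" .
      then show ?thesis
        by (simp add: Q_defect_def[of _ _ _ _ f] f\<pi>[OF V] N.minus_eq N.r_neg)
    qed
    \<comment> \<open>The Bianchi identity: \<open>Q\<^sub>1 F h\<close> and \<open>- F (Q\<^sub>2 h)\<close> both equal \<open>- Q\<^sub>1 (\<phi> (Q\<^sub>2 h))\<close>.\<close>
    show "Q_defect M\<^sub>1 Q\<^sub>1 ?D \<phi>\<^sub>0 f V (d V (\<pi> V h)) = \<zero>\<^bsub>sections M\<^sub>1 (?pre V)\<^esub>"
    proof -
      let ?x = "Q\<^sub>1 (?pre V) (\<phi> V (Q\<^sub>2 V h))"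
      have "f V (?D V (d V (\<pi> V h))) = \<ominus>\<^bsub>sections M\<^sub>1 (?pre V)\<^esub> ?x"
        by (simp add: gen graded_hom_neg[OF gT[OF V] N.gc_algebra_axioms fh[OF V]] fd[OF V]
            Q_defect_def QQ \<phi>0 N.minus_eq)
      moreover have "Q\<^sub>1 (?pre V) (f V (d V (\<pi> V h))) = \<ominus>\<^bsub>sections M\<^sub>1 (?pre V)\<^esub> ?x"
        by (simp add: fd[OF V] Q_defect_def N.minus_eq graded_derivationD(2)[OF Q1D[OF V]]
            QQ1[OF pre[OF V]]
            derivation_neg[OF N.gc_algebra_axioms N.gc_algebra_axioms Q1D[OF V]])
      ultimately show ?thesis
        by (simp add: Q_defect_def[of _ _ _ _ f] N.minus_eq N.l_neg)
    qed
  qed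
  then show ?thesis
    using assms(1) T(1,2) hD f by (simp add: Q_morphism_def Q_manifold_def)
qed

end
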